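(* Let $S,T\in\mathbf T_n$ be standard Young tableaux with $S\stackrel{G}{\le}T$ (that is, $\overline{\mathcal V}_T\subset\overline{\mathcal V}_S$ in $\mathfrak{sl}_n$). Then for every $a\in\{1,\dots,n+1\}$ one has $$(\overline S_a\Downarrow a)\stackrel{G}{\le}(\overline T_a\Downarrow a)\qquad\text{and}\qquad (a\Rightarrow\overline S_a)\stackrel{G}{\le}(a\Rightarrow\overline T_a)$$ in $\mathbf T_{n+1}$ (where now the geometric order is that of $\mathfrak{sl}_{n+1}$).
   Context: $\mathbf T_n$ is the set of standard Young tableaux with $n$ boxes. Let $\mathfrak g=\mathfrak{sl}_n(\mathbb C)$, $\mathbf G=SL_n(\mathbb C)$, $\mathbf B$ the upper triangular subgroup and $\mathfrak n$ the strictly upper triangular matrices, with conjugation action. For $w\in\mathbf S_n$, written as a word $[w(1),\dots,w(n)]$, put $\mathfrak n\cap{}^w\mathfrak n=\operatorname{span}\{e_{ij}: i<j,\ w^{-1}(i)<w^{-1}(j)\}$. The closure $\overline{\mathbf G(\mathfrak n\cap{}^w\mathfrak n)}$ is the closure of a unique nilpotent orbit $\mathcal O_w$, and $\mathcal V_w:=\overline{\mathbf B(\mathfrak n\cap{}^w\mathfrak n)}\cap\mathcal O_w$ is an orbital variety (irreducible component of $\mathcal O_w\cap\mathfrak n$). Let $P(w)$ be the Robinson–Schensted insertion tableau of the word $w$ (row insert $w(1),\dots,w(n)$ successively). It is known that $\mathcal V_w=\mathcal V_y$ iff $P(w)=P(y)$; for $T\in\mathbf T_n$ put $\mathcal V_T:=\mathcal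 V_w$ for any $w$ with $P(w)=T$. The geometric order on $\mathbf T_n$ is: $T\stackrel{G}{\le}S$ iff $\overline{\mathcal V}_T\supset\overline{\mathcal V}_S$. For $T\in\mathbf T_n$ and $a\in\{1,\dots,n+1\}$, $\overline T_a$ is obtained from $T$ by replacing each entry $b\ge a$ by $b+1$ and leaving the entries $b<a$ unchanged. $(\overline T_a\Downarrow a)$ is the Robinson–Schensted row insertion of $a$ into $\overline T_a$, and $(a\Rightarrow\overline T_a)$ is the column insertion of $a$ into $\overline T_a$. Equivalently, if $T=P(w)$ and $\overline w_a$ is obtained from the word $w$ by raising by $1$ all letters $\ge a$, then $(\overline T_a\Downarrow a)=P([\overline w_a,a])$ and $(a\Rightarrow\overline T_a)=P([a,\overline w_a])$. *)

theory Defs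
  imports Complex_Main "HOL-Combinatorics.Permutations" "Jordan_Normal_Form.Jordan_Normal_Form"
begin

text \<open>Tableaux are lists of rows, top row first, without empty rows.\<close>

definition SYT :: "nat \<Rightarrow> nat list list set" where
  "SYT n = {T. [] \<notin> set T \<and> sorted_wrt (\<ge>) (map length T) \<and>
     distinct (concat T) \<and> set (concat T) = {1..n} \<and>
     (\<forall>r\<in>set T. sorted_wrt (<) r) \<and>
     (\<forall>i j. Suc i < length T \<longrightarrow> j < length (T ! Suc i) \<longrightarrow> T ! i ! j < T ! Suc i ! j)}"

text \<open>The entries are always pairwise distinct, so it does not matter whether an inserted entry
  bumps the leftmost entry that is larger or the leftmost one that is not smaller.\<close>

fun row_insert :: "nat list list \<Rightarrow> nat \<Rightarrow> nat list list" where
  "row_insert [] x = [[x]]"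
| "row_insert (r # T) x =
     (case dropWhile (\<lambda>y. y < x) r of
        [] \<Rightarrow> (r @ [x]) # T
      | y # ys \<Rightarrow> (takeWhile (\<lambda>y. y < x) r @ x # ys) # row_insert T y)"

text \<open>In column insertion, the columns take the role of the rows.\<close>

definition col_insert :: "nat \<Rightarrow> nat list list \<Rightarrow> nat list list" where
  "col_insert x T = List.transpose (row_insert (List.transpose T) x)"

definition insertion_tableau :: "nat list \<Rightarrow> nat list list" where
  "insertion_tableau xs = foldl row_insert [] xs"

definition word_of_perm :: "nat \<Rightarrow> (nat \<Rightarrow> nat) \<Rightarrow> nat list" where
  "word_of_perm n w = map w [1..<Suc n]"

definition raise_entries :: "nat \<Rightarrow> nat list list \<Rightarrow> nat list list" where
  "raise_entries a T = map (map (\<lambda>b. if a \<le> b then b + 1 else b)) T"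

definition sl :: "nat \<Rightarrow> complex mat set" where
  "sl n = {X \<in> carrier_mat n n. (\<Sum>i<n. X $$ (i, i)) = 0}"

definition SL :: "nat \<Rightarrow> complex mat set" where
  "SL n = {g \<in> carrier_mat n n. det g = 1}"

definition SL_borel :: "nat \<Rightarrow> complex mat set" where
  "SL_borel n = {g \<in> SL n. upper_triangular g}"

text \<open>\<open>conj_sat H M\<close> is the union of all \<open>g M g\<^sup>-\<^sup>1\<close> with \<open>g \<in> H\<close>.\<close>

definition conj_sat :: "complex mat set \<Rightarrow> complex mat set \<Rightarrow> complex mat set" where
  "conj_sat H M = {Y. \<exists>X\<in>M. \<exists>g\<in>H. \<exists>h. similar_mat_wit Y X g h}"

text \<open>All closures are Zariski closures in \<open>sl n\<close>.  The polynomial functions on \<open>sl n\<close> are the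
  restrictions of the polynomial functions on all \<open>n \<times> n\<close> matrices.\<close>

inductive_set poly_funs :: "nat \<Rightarrow> (complex mat \<Rightarrow> complex) set" for n :: nat where
  const: "(\<lambda>X. c) \<in> poly_funs n"
| coord: "i < n \<Longrightarrow> j < n \<Longrightarrow> (\<lambda>X. X $$ (i, j)) \<in> poly_funs n"
| add: "f \<in> poly_funs n \<Longrightarrow> g \<in> poly_funs n \<Longrightarrow> (\<lambda>X. f X + g X) \<in> poly_funs n"
| mult: "f \<in> poly_funs n \<Longrightarrow> g \<in> poly_funs n \<Longrightarrow> (\<lambda>X. f X * g X) \<in> poly_funs n"

definition zariski_closure :: "nat \<Rightarrow> complex mat set \<Rightarrow> complex mat set" where
  "zariski_closure n M = {X \<in> sl n. \<forall>f\<in>poly_funs n. (\<forall>Y\<in>M. f Y = 0) \<longrightarrow> f X = 0}"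

definition nilpotent_orbits :: "nat \<Rightarrow> complex mat set set" where
  "nilpotent_orbits n =
     {conj_sat (SL n) {X} | X. X \<in> sl n \<and> (\<exists>k. X ^\<^sub>m k = 0\<^sub>m n n)}"

text \<open>Matrix entries are indexed from 0, letters of words from 1: the matrix unit \<open>e\<^sub>i\<^sub>j\<close>
  of the usual notation sits at the entry \<open>(i - 1, j - 1)\<close>.  The matrices below are therefore
  exactly those in the span of all \<open>e\<^sub>i\<^sub>j\<close> with \<open>i < j\<close> and \<open>w\<^sup>-\<^sup>1(i) < w\<^sup>-\<^sup>1(j)\<close>.\<close>

definition n_cap_w :: "nat \<Rightarrow> (nat \<Rightarrow> nat) \<Rightarrow> complex mat set" where
  "n_cap_w n w = {X \<in> carrier_mat n n. \<forall>i<n. \<forall>j<n.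
     X $$ (i, j) \<noteq> 0 \<longrightarrow> i < j \<and> inv_into UNIV w (Suc i) < inv_into UNIV w (Suc j)}"

definition orbit_of_perm :: "nat \<Rightarrow> (nat \<Rightarrow> nat) \<Rightarrow> complex mat set" where
  "orbit_of_perm n w = (THE C. C \<in> nilpotent_orbits n \<and>
     zariski_closure n C = zariski_closure n (conj_sat (SL n) (n_cap_w n w)))"

definition orbital_variety_perm :: "nat \<Rightarrow> (nat \<Rightarrow> nat) \<Rightarrow> complex mat set" where
  "orbital_variety_perm n w =
     zariski_closure n (conj_sat (SL_borel n) (n_cap_w n w)) \<inter> orbit_of_perm n w"

text \<open>The choice of \<open>w\<close> is immaterial: permutations with the same insertion tableau have the
  same orbital variety.\<close>

definition orbital_variety :: "nat \<Rightarrow> nat list list \<Rightarrow> complex mat set" where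
  "orbital_variety n T = orbital_variety_perm n
     (SOME w. w permutes {1..n} \<and> insertion_tableau (word_of_perm n w) = T)"

definition geom_le :: "nat \<Rightarrow> nat list list \<Rightarrow> nat list list \<Rightarrow> bool" where
  "geom_le n T S \<longleftrightarrow> T \<in> SYT n \<and> S \<in> SYT n \<and>
     zariski_closure n (orbital_variety n S) \<subseteq> zariski_closure n (orbital_variety n T)"

end

theory Submission
  imports Defs "Jordan_Normal_Form.Jordan_Normal_Form_Existence"
    "Jordan_Normal_Form.Jordan_Normal_Form_Uniqueness"
begin

text \<open>The closure of \<open>\<V>\<^sub>w\<close> is the closure of \<open>B(n \<inter> \<^sup>wn)\<close>: the matrices of \<open>n \<inter> \<^sup>wn\<close> for which all kernels of
  powers have minimal dimension are dense, and they lie in a single nilpotent orbit because these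
  dimensions determine the Jordan type.  A Knuth move on the word \<open>w\<close> changes \<open>n \<inter> \<^sup>wn\<close> by one matrix
  unit, which generically can be removed by conjugation with a transvection, so this closure depends
  only on the Knuth class of \<open>w\<close>.

  Row insertion of \<open>a\<close> appends \<open>a\<close> to the reading word up to Knuth moves, and column insertion puts
  \<open>a\<close> in front.  The matrices of the longer word are those of the shorter one with a new \<open>a\<close>-th row and
  column inserted, where only the part of the column above the diagonal, respectively the part of the
  row to the right of the diagonal, is arbitrary.  The smaller Borel group, embedded with entry 1 at
  \<open>(a, a)\<close>, preserves this shape, so an inclusion of closures carries over from \<open>n\<close> to \<open>n + 1\<close>.\<close>

section \<open>Knuth equivalence and tableaux\<close>

text \<open>Two choices hide in the definition of an orbital variety: the orbit is a definite
  description and the permutation a \<open>SOME\<close>. The first is settled by upper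
  semicontinuity of kernel dimensions, which forces nilpotent orbits with equal closures to
  coincide. For the second, every permutation with insertion tableau \<open>T\<close> has a word
  Knuth equivalent to the row reading word of \<open>T\<close>; that such a permutation exists is
  shown by the column word, whose insertion can be followed column by column. Column words also
  explain column insertion: it is row insertion into the transpose, and reversing words preserves
  Knuth equivalence. In the last part the obstacle is that the given inclusion concerns closures
  only, so a matrix of one space is not known to be a conjugate of a matrix of the other. It is met
  by freezing the new row or column: bordering with fixed entries is a polynomial map and therefore
  respects closures.\<close>

inductive knuth :: "'a::linorder list \<Rightarrow> 'a list \<Rightarrow> bool" where
  knuth_refl: "knuth u u"
| knuth_sym: "knuth u v \<Longrightarrow> knuth v u"
| knuth_trans: "knuth u v \<Longrightarrow> knuth v w \<Longrightarrow> knuth u w"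
| yxz: "x < y \<Longrightarrow> y < z \<Longrightarrow> knuth (u @ [y, x, z] @ v) (u @ [y, z, x] @ v)"
| xzy: "x < y \<Longrightarrow> y < z \<Longrightarrow> knuth (u @ [x, z, y] @ v) (u @ [z, x, y] @ v)"

declare knuth_refl [simp, intro] knuth_trans [trans]

lemma knuth_context: "knuth p q \<Longrightarrow> knuth (u @ p @ v) (u @ q @ v)"
proof (induction rule: knuth.induct)
  case (yxz x y z u' v')
  then show ?case using knuth.yxz[of x y z "u @ u'" "v' @ v"] by simp
next
  case (xzy x y z u' v')
  then show ?case using knuth.xzy[of x y z "u @ u'" "v' @ v"] by simp
qed (auto intro: knuth_sym knuth_trans)

lemma knuth_appendI: "knuth p q \<Longrightarrow> knuth (p @ v) (q @ v)"
  using knuth_context[of p q "[]" v] by simp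

lemma knuth_appendI2: "knuth p q \<Longrightarrow> knuth (u @ p) (u @ q)"
  using knuth_context[of p q u "[]"] by simp

lemma knuth_rev: "knuth p q \<Longrightarrow> knuth (rev p) (rev q)"
proof (induction rule: knuth.induct)
  case (yxz x y z u v)
  then show ?case using knuth_sym[OF knuth.xzy[of x y z "rev v" "rev u"]] by simp
next
  case (xzy x y z u v)
  then show ?case using knuth_sym[OF knuth.yxz[of x y z "rev v" "rev u"]] by simp
qed (auto intro: knuth_sym knuth_trans)

lemma knuth_mset: "knuth p q \<Longrightarrow> mset p = mset q"
  by (induction rule: knuth.induct) auto

text \<open>\<open>x\<close> passes the letters of \<open>q\<close> from right to left. At each
  exchange the letter in front of the pair belongs to the row, so it lies between \<open>x\<close>
  and the letter being passed and plays the middle role in \<open>yxz\<close>.\<close>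

lemma knuth_move_left:
  "sorted_wrt (<) (y # q) \<Longrightarrow> x < y \<Longrightarrow> knuth (y # q @ [x]) (y # x # q)"
proof (induction q arbitrary: y)
  case (Cons z q)
  have "knuth (z # q @ [x]) (z # x # q)" using Cons by auto
  then have "knuth (y # z # q @ [x]) (y # z # x # q)"
    using knuth_appendI2[of _ _ "[y]"] by fastforce
  also have "knuth (y # z # x # q) (y # x # z # q)"
    using Cons.prems knuth_sym[OF knuth.yxz[of x y z "[]" q]] by simp
  finally show ?case by simp
qed simp

text \<open>\<open>y\<close> passes the letters of \<open>p\<close> from right to left. At each
  exchange the next letter of \<open>p @ [x]\<close> follows the pair; it lies between the passed
  letter and \<open>y\<close> and plays the middle role in \<open>xzy\<close>. The final
  \<open>x\<close> takes this role for the last letter of \<open>p\<close>.\<close>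

lemma knuth_move_front:
  "sorted_wrt (<) (p @ [x]) \<Longrightarrow> x < y \<Longrightarrow> knuth (p @ [y, x]) (y # p @ [x])"
proof (induction p)
  case (Cons z p)
  have "knuth (p @ [y, x]) (y # p @ [x])" using Cons by auto
  then have "knuth (z # p @ [y, x]) (z # y # p @ [x])"
    using knuth_appendI2[of _ _ "[z]"] by fastforce
  also have "knuth (z # y # p @ [x]) (y # z # p @ [x])"
  proof -
    obtain w p' where "p @ [x] = w # p'" by (cases p) auto
    then show ?thesis
      using Cons.prems knuth.xzy[of z w y "[]" p'] by (cases p) auto
  qed
  finally show ?case by simp
qed simp

text \<open>One bumping step: \<open>x\<close> takes the place of \<open>y\<close>, and
  \<open>y\<close> leaves at the left end of the row. In the reading from the bottom row upwards
  this is exactly the end of the word of the lower rows.\<close>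

lemma knuth_bump:
  assumes "sorted_wrt (<) (p @ y # q)" "x < y" "\<forall>z\<in>set p. z < x"
  shows "knuth (p @ y # q @ [x]) (y # p @ x # q)"
proof -
  have "knuth (p @ y # q @ [x]) (p @ y # x # q)"
    by (rule knuth_appendI2, rule knuth_move_left) (use assms in \<open>auto simp: sorted_wrt_append\<close>)
  also have "knuth (p @ y # x # q) (y # p @ x # q)"
    using knuth_appendI[OF knuth_move_front[of p x y], of q] assms
    by (auto simp: sorted_wrt_append)
  finally show ?thesis .
qed

text \<open>The shape and monotonicity conditions of \<open>SYT\<close> without those on the set of
  entries, so that raised tableaux, which miss the letter \<open>a\<close>, and intermediate results
  of insertion are covered.\<close>

definition tableau :: "nat list list \<Rightarrow> bool" where
  "tableau T \<longleftrightarrow> [] \<notin> set T \<and> sorted_wrt (\<ge>) (map length T) \<and> (\<forall>r\<in>set T. sorted_wrt (<) r) \<and>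
     (\<forall>i j. Suc i < length T \<longrightarrow> j < length (T ! Suc i) \<longrightarrow> T ! i ! j < T ! Suc i ! j)"

lemma SYT_iff: "T \<in> SYT n \<longleftrightarrow> tableau T \<and> distinct (concat T) \<and> set (concat T) = {1..n}"
  by (auto simp: SYT_def tableau_def)

lemma tableau_Nil [simp]: "tableau []"
  by (simp add: tableau_def)

lemma tableau_Cons:
  "tableau (r # T) \<longleftrightarrow> r \<noteq> [] \<and> sorted_wrt (<) r \<and> tableau T \<and>
     (T \<noteq> [] \<longrightarrow> length (hd T) \<le> length r \<and> (\<forall>j<length (hd T). r ! j < hd T ! j))"
proof (cases T)
  case Nil
  then show ?thesis by (auto simp: tableau_def)
next
  case (Cons s U)
  have "(\<forall>i j. Suc i < length (r # T) \<longrightarrow> j < length ((r # T) ! Suc i) \<longrightarrow>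
           (r # T) ! i ! j < (r # T) ! Suc i ! j) \<longleftrightarrow>
        (\<forall>j<length s. r ! j < s ! j) \<and>
        (\<forall>i j. Suc i < length T \<longrightarrow> j < length (T ! Suc i) \<longrightarrow> T ! i ! j < T ! Suc i ! j)"
    (is "?A \<longleftrightarrow> ?B \<and> ?C")
  proof (intro iffI conjI)
    assume ?A
    then show ?B using Cons by force
    show ?C using \<open>?A\<close> by (metis Suc_less_eq length_Cons nth_Cons_Suc)
  next
    assume *: "?B \<and> ?C"
    show ?A
    proof (intro allI impI)
      fix i j assume "Suc i < length (r # T)" "j < length ((r # T) ! Suc i)"
      then show "(r # T) ! i ! j < (r # T) ! Suc i ! j"
        using * Cons by (cases i) auto
    qed
  qed
  then show ?thesis unfolding tableau_def using Cons
    by (auto dest: order_trans)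
qed

lemma tableau_column_less:
  assumes "tableau T" "i < k" "k < length T" "j < length (T ! k)"
  shows "T ! i ! j < T ! k ! j"
  using assms(2-4)
proof (induction k)
  case (Suc k)
  have le: "length (T ! Suc k) \<le> length (T ! k)"
    using assms(1) Suc.prems(2) by (auto simp: tableau_def sorted_wrt_iff_nth_less)
  have step: "T ! k ! j < T ! Suc k ! j"
    using assms(1) Suc.prems by (auto simp: tableau_def)
  show ?case
  proof (cases "i = k")
    case False
    then have "T ! i ! j < T ! k ! j" using Suc le by auto
    then show ?thesis using step by simp
  qed (use step in simp)
qed simp

section \<open>Row insertion realised by Knuth moves\<close>

lemma row_insert_append:
  "\<forall>z\<in>set r. z < x \<Longrightarrow> row_insert (r # T) x = (r @ [x]) # T"
  using dropWhile_eq_Nil_conv[of "\<lambda>y. y < x" r] by (simp del: dropWhile_eq_Nil_conv)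

lemma mset_row_insert: "mset (concat (row_insert T x)) = add_mset x (mset (concat T))"
proof (induction T arbitrary: x)
  case (Cons r T)
  show ?case
  proof (cases "dropWhile (\<lambda>y. y < x) r")
    case Nil
    then show ?thesis using row_insert_append[of r x T] by simp
  next
    case (Cons y q)
    have r: "r = takeWhile (\<lambda>y. y < x) r @ y # q"
      using takeWhile_dropWhile_id[of "\<lambda>y. y < x" r] Cons by simp
    have "mset r = mset (takeWhile (\<lambda>y. y < x) r) + add_mset y (mset q)"
      by (subst r) simp
    then show ?thesis using Cons Cons.IH[of y] by simp
  qed
qed simp

lemma row_insert_cases [consumes 2, case_names append bump]:
  assumes "sorted_wrt (<) r" "x \<notin> set r"
  obtains "\<forall>z\<in>set r. z < x" "row_insert (r # T) x = (r @ [x]) # T"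
  | p y q where "r = p @ y # q" "\<forall>z\<in>set p. z < x" "x < y"
      "row_insert (r # T) x = (p @ x # q) # row_insert T y"
proof (cases "dropWhile (\<lambda>y. y < x) r")
  case Nil
  then show ?thesis using that(1) row_insert_append[of r x T] by simp
next
  case (Cons y q)
  let ?p = "takeWhile (\<lambda>y. y < x) r"
  have r: "r = ?p @ y # q"
    using takeWhile_dropWhile_id[of "\<lambda>y. y < x" r] Cons by simp
  then have "y \<in> set r" by (metis in_set_conv_decomp)
  moreover have "\<not> y < x" using Cons hd_dropWhile[of "\<lambda>y. y < x" r] by simp
  ultimately have "x < y" using assms(2) by (metis linorder_neqE_nat)
  then show ?thesis using that(2)[of ?p y q] r Cons by (auto dest: set_takeWhileD)
qed

lemma tableau_row_insert:
  "tableau T \<Longrightarrow> distinct (concat T) \<Longrightarrow> x \<notin> set (concat T) \<Longrightarrow> tableau (row_insert T x)"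
proof (induction T arbitrary: x)
  case Nil
  then show ?case by (simp add: tableau_Cons)
next
  case (Cons r T)
  have r: "sorted_wrt (<) r" "r \<noteq> []" and x: "x \<notin> set r"
    and T: "tableau T" and dT: "distinct (concat T)"
    and dom: "T \<noteq> [] \<Longrightarrow> length (hd T) \<le> length r"
      "\<And>j. T \<noteq> [] \<Longrightarrow> j < length (hd T) \<Longrightarrow> r ! j < hd T ! j"
    using Cons.prems by (auto simp: tableau_Cons)
  from r(1) x show ?case
  proof (cases rule: row_insert_cases[where T = T])
    case append
    then show ?thesis using r T dom
      by (auto simp: tableau_Cons sorted_wrt_append nth_append)
  next
    case (bump p y q)
    let ?r = "p @ x # q"
    have y: "y \<notin> set (concat T)" using Cons.prems(2) bump(1) by auto
    then have ins: "tableau (row_insert T y)" using Cons.IH T dT by blast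
    have sr: "sorted_wrt (<) ?r" using r(1) bump by (fastforce simp: sorted_wrt_append)
    have le_r: "?r ! j \<le> r ! j" for j
      using bump by (auto simp: nth_append nth_Cons split: nat.split)
    \<comment> \<open>Up to the place of the bump the changed row is below \<open>y\<close>, so
      \<open>y\<close> may be put under any of these entries.\<close>
    have le_x: "?r ! j < y" if "j \<le> length p" for j
    proof (cases "j < length p")
      case True
      then have "p ! j < x" using bump(2) by simp
      then show ?thesis using bump(3) True by (simp add: nth_append)
    next
      case False
      then show ?thesis using that bump by auto
    qed
    have "length (hd (row_insert T y)) \<le> length ?r \<and>
      (\<forall>j<length (hd (row_insert T y)). ?r ! j < hd (row_insert T y) ! j)"
    proof (cases T)
      case Nil
      then show ?thesis using le_x[of 0] by simp
    next
      case TC: (Cons s U)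
      have s: "sorted_wrt (<) s" "y \<notin> set s" using T y TC by (auto simp: tableau_Cons)
      have rs: "length s \<le> length r" "r ! j < s ! j" if "j < length s" for j
        using dom TC that by auto
      have ls: "length s \<le> length r" using dom TC by simp
      \<comment> \<open>The bumped entry moves weakly to the left: otherwise the entry of
        \<open>s\<close> under its old place would be larger than \<open>y\<close> by the column
        condition and smaller than \<open>y\<close> at the same time.\<close>
      have bound: "k \<le> length p" if "\<And>j. j < k \<Longrightarrow> s ! j < y" "k \<le> length s" for k
      proof (rule ccontr)
        assume "\<not> k \<le> length p"
        then have "length p < k" by simp
        then have "r ! length p < s ! length p" "s ! length p < y" using rs(2) that by auto
        then show False using bump(1) by simp
      qed
      from s show ?thesis
      proof (cases rule: row_insert_cases[where T = U])
        case append
        have "length s \<le> length p" by (rule bound) (use append in auto)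
        then show ?thesis unfolding TC append(2) using le_r rs(2) le_x bump(1)
          by (fastforce simp: nth_append intro: le_less_trans)
      next
        case ss: (bump p' z q')
        have k: "length p' \<le> length p"
          by (rule bound) (use ss in \<open>auto simp: nth_append\<close>)
        have "?r ! j < (p' @ y # q') ! j" if "j < length s" for j
        proof (cases "j = length p'")
          case True
          then show ?thesis using le_x[of j] k by simp
        next
          case False
          then have "(p' @ y # q') ! j = s ! j" using ss(1) by (auto simp: nth_append nth_Cons split: nat.split)
          then show ?thesis using le_r rs(2) that by (metis le_less_trans)
        qed
        then show ?thesis unfolding TC ss(4) using ls ss(1) bump(1) by simp
      qed
    qed
    then show ?thesis unfolding bump(4) using sr ins by (simp add: tableau_Cons)
  qed
qed

text \<open>Inside the top row the insertion is \<open>knuth_bump\<close>; it leaves the bumped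
  letter right behind the word of the remaining rows, where the induction hypothesis
  applies.\<close>

lemma knuth_row_insert:
  "tableau T \<Longrightarrow> distinct (concat T) \<Longrightarrow> x \<notin> set (concat T) \<Longrightarrow>
    knuth (concat (rev T) @ [x]) (concat (rev (row_insert T x)))"
proof (induction T arbitrary: x)
  case (Cons r T)
  then have "sorted_wrt (<) r" "x \<notin> set r" by (auto simp: tableau_Cons)
  then show ?case
  proof (cases rule: row_insert_cases[where T = T])
    case append
    then show ?thesis unfolding append(2) by simp
  next
    case (bump p y q)
    have "knuth (p @ y # q @ [x]) (y # p @ x # q)"
      by (rule knuth_bump) (use bump Cons.prems in \<open>auto simp: tableau_Cons\<close>)
    then have "knuth (concat (rev T) @ p @ y # q @ [x]) (concat (rev T) @ [y] @ p @ x # q)"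
      using knuth_appendI2 by fastforce
    also have "concat (rev T) @ [y] @ p @ x # q = (concat (rev T) @ [y]) @ p @ x # q" by simp
    also have "knuth \<dots> (concat (rev (row_insert T y)) @ p @ x # q)"
      by (intro knuth_appendI Cons.IH) (use bump Cons.prems in \<open>auto simp: tableau_Cons\<close>)
    finally show ?thesis unfolding bump(4) using bump(1) by simp
  qed
qed simp

lemma insertion_tableau_snoc: "insertion_tableau (w @ [x]) = row_insert (insertion_tableau w) x"
  by (simp add: insertion_tableau_def)

lemma mset_insertion_tableau: "mset (concat (insertion_tableau w)) = mset w"
  by (induction w rule: rev_induct)
    (simp_all add: insertion_tableau_def mset_row_insert del: mset_concat)

lemma tableau_insertion_tableau:
  assumes "distinct w"
  shows "tableau (insertion_tableau w) \<and> knuth w (concat (rev (insertion_tableau w)))"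
  using assms
proof (induction w rule: rev_induct)
  case Nil
  then show ?case by (simp add: insertion_tableau_def)
next
  case (snoc x w)
  let ?T = "insertion_tableau w"
  have "distinct (concat ?T)" "x \<notin> set (concat ?T)"
    using snoc.prems mset_eq_imp_distinct_iff[OF mset_insertion_tableau[of w]]
      mset_eq_setD[OF mset_insertion_tableau[of w]] by simp_all
  moreover have "tableau ?T" "knuth (w @ [x]) (concat (rev ?T) @ [x])"
    using snoc by (auto intro: knuth_appendI)
  ultimately show ?case
    using tableau_row_insert knuth_row_insert knuth_trans unfolding insertion_tableau_snoc by blast
qed

section \<open>Column words and column insertion\<close>

fun append_column :: "'a list list \<Rightarrow> 'a list \<Rightarrow> 'a list list" where
  "append_column T [] = T"
| "append_column [] (y # ys) = [y] # append_column [] ys"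
| "append_column (r # T) (y # ys) = (r @ [y]) # append_column T ys"

lemma length_append_column: "length (append_column T c) = max (length T) (length c)"
  by (induction T c rule: append_column.induct) auto

lemma nth_append_column:
  "i < max (length T) (length c) \<Longrightarrow> append_column T c ! i =
    (if i < length T then T ! i else []) @ (if i < length c then [c ! i] else [])"
proof (induction T c arbitrary: i rule: append_column.induct)
  case (2 y ys)
  then show ?case by (cases i) auto
next
  case (3 r T y ys)
  then show ?case by (cases i) auto
qed simp

lemma append_column_transpose:
  "append_column (List.transpose C) c = List.transpose (C @ [c])"
proof (rule nth_equalityI)
  have fm: "foldr (\<lambda>xs. max (length xs)) C (k::nat) = max (foldr (\<lambda>xs. max (length xs)) C 0) k" for k
  proof (induction C)
    case (Cons a C)
    show ?case unfolding foldr.simps comp_def by (subst Cons.IH) (rule max.assoc[symmetric])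
  qed simp
  show len: "length (append_column (List.transpose C) c) = length (List.transpose (C @ [c]))"
    by (simp add: length_append_column length_transpose fm[of "length c"])
  fix i assume i: "i < length (append_column (List.transpose C) c)"
  have *: "filter (\<lambda>ys. i < length ys) C = []" if "\<not> i < length (List.transpose C)"
  proof -
    have "length ys \<le> foldr (\<lambda>xs. max (length xs)) C 0" if "ys \<in> set C" for ys
      using that by (induction C) auto
    then show ?thesis using that by (auto simp: length_transpose filter_empty_conv not_less intro: order_trans)
  qed
  show "append_column (List.transpose C) c ! i = List.transpose (C @ [c]) ! i"
    using i * len by (auto simp: nth_append_column length_append_column nth_transpose)
qed

text \<open>In the top row \<open>x\<close> exceeds all entries of \<open>T\<close> but not the head
  of \<open>c\<close>, so it bumps this head into the next row, where the same happens. The effect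
  is that the column slides down by one place.\<close>

lemma row_insert_append_column:
  "sorted_wrt (<) (x # c) \<Longrightarrow>
   (\<And>i z. i < length T \<Longrightarrow> i < length (x # c) \<Longrightarrow> z \<in> set (T ! i) \<Longrightarrow> z < (x # c) ! i) \<Longrightarrow>
   row_insert (append_column T c) x = append_column T (x # c)"
proof (induction c arbitrary: T x)
  case Nil
  then show ?case
  proof (cases T)
    case (Cons r T')
    then have "\<forall>z\<in>set r. z < x" using Nil(2)[of 0] by auto
    then show ?thesis using Cons by (simp add: row_insert_append del: row_insert.simps)
  qed simp
next
  case (Cons y c)
  have IH: "row_insert (append_column (tl T) c) y = append_column (tl T) (y # c)"
  proof (rule Cons.IH)
    fix i z assume "i < length (tl T)" "i < length (y # c)" "z \<in> set (tl T ! i)"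
    then show "z < (y # c) ! i" using Cons.prems(2)[of "Suc i" z] by (cases T) auto
  qed (use Cons.prems in auto)
  show ?case
  proof (cases T)
    case Nil
    then show ?thesis using IH Cons.prems(1) by simp
  next
    case TC: (Cons r T')
    have r: "\<forall>z\<in>set r. z < x" using Cons.prems(2)[of 0] TC by auto
    then have "dropWhile (\<lambda>y. y < x) (r @ [y]) = [y]" "takeWhile (\<lambda>y. y < x) (r @ [y]) = r"
      using Cons.prems(1) by (auto simp: dropWhile_append takeWhile_append)
    then show ?thesis using IH TC by simp
  qed
qed

lemma foldl_row_insert_rev:
  "sorted_wrt (<) c \<Longrightarrow>
   (\<And>i z. i < length T \<Longrightarrow> i < length c \<Longrightarrow> z \<in> set (T ! i) \<Longrightarrow> z < c ! i) \<Longrightarrow>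
   foldl row_insert T (rev c) = append_column T c"
proof (induction c)
  case (Cons x c)
  have "foldl row_insert T (rev c) = append_column T c"
  proof (rule Cons.IH)
    fix i z assume *: "i < length T" "i < length c" "z \<in> set (T ! i)"
    then have "z < (x # c) ! i" using Cons.prems(2)[of i z] by auto
    also have "\<dots> < c ! i" using Cons.prems(1) *(2)
      sorted_wrt_nth_less[of "(<)" "x # c" i "Suc i"] by simp
    finally show "z < c ! i" .
  qed (use Cons.prems in auto)
  then show ?case using row_insert_append_column[of x c T] Cons.prems by simp
qed simp

lemma tableau_appendD: "tableau (C @ D) \<Longrightarrow> tableau C"
  unfolding tableau_def
proof (elim conjE, intro conjI allI impI)
  fix i j
  assume "\<forall>i j. Suc i < length (C @ D) \<longrightarrow> j < length ((C @ D) ! Suc i) \<longrightarrow> (C @ D) ! i ! j < (C @ D) ! Suc i ! j"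
    "Suc i < length C" "j < length (C ! Suc i)"
  then show "C ! i ! j < C ! Suc i ! j"
    by (metis Suc_lessD length_append nth_append trans_less_add1)
qed (auto simp: sorted_wrt_append)

text \<open>The rows of \<open>C\<close> stand for the columns of the result. Each is inserted from
  its largest entry down and becomes a new last column, since it dominates the earlier columns row
  by row. The first column is attached to the empty tableau, which is why
  \<open>append_column\<close> can create rows.\<close>

lemma insertion_tableau_columns:
  "tableau C \<Longrightarrow> insertion_tableau (concat (map rev C)) = List.transpose C"
proof (induction C rule: rev_induct)
  case Nil
  then show ?case by (simp add: insertion_tableau_def)
next
  case (snoc c C)
  have "foldl row_insert (List.transpose C) (rev c) = append_column (List.transpose C) c"
  proof (rule foldl_row_insert_rev)
    show "sorted_wrt (<) c" using snoc.prems by (auto simp: tableau_def)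
    fix i z assume *: "i < length (List.transpose C)" "i < length c" "z \<in> set (List.transpose C ! i)"
    then obtain d where "d \<in> set C" "z = d ! i" by (auto simp: nth_transpose)
    then obtain k where "k < length C" "z = C ! k ! i" by (auto simp: in_set_conv_nth)
    then show "z < c ! i"
      using tableau_column_less[OF snoc.prems, of k "length C" i] *(2) by (simp add: nth_append)
  qed
  then show ?case using snoc tableau_appendD[of C "[c]"]
    by (simp add: insertion_tableau_def append_column_transpose)
qed

lemma tableau_sorted_rev: "tableau T \<Longrightarrow> sorted (rev (map length T))"
  by (simp add: tableau_def sorted_wrt_rev)

lemma transpose_transpose_tableau:
  assumes "tableau T" shows "List.transpose (List.transpose T) = T"
proof -
  have "takeWhile (\<lambda>x. x \<noteq> []) T = T"
    using assms by (auto simp: tableau_def takeWhile_eq_all_conv)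
  then show ?thesis using List.transpose_transpose[OF tableau_sorted_rev[OF assms]] by simp
qed

lemma transpose_tableau_nth:
  assumes "tableau T" "i < length (List.transpose T)" "j < length (List.transpose T ! i)"
  shows "j < length T" "i < length (T ! j)" "List.transpose T ! i ! j = T ! j ! i"
proof -
  let ?P = "\<lambda>ys. i < length ys"
  have "sorted_wrt (\<ge>) (map length T)" using assms(1) by (simp add: tableau_def)
  \<comment> \<open>As the row lengths decrease weakly, the rows that reach column \<open>i\<close>
    form an initial segment, and so positions within a column are row numbers.\<close>
  then have f: "filter ?P T = takeWhile ?P T"
    by (induction T) (auto simp: filter_empty_conv takeWhile_eq_Nil_iff dest!: hd_in_set)
  have j: "j < length (takeWhile ?P T)"
    using assms(2,3) f by (simp add: nth_transpose)
  then show "j < length T" using length_takeWhile_le order_less_le_trans by blast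
  show "i < length (T ! j)" using j by (metis nth_mem set_takeWhileD takeWhile_nth)
  show "List.transpose T ! i ! j = T ! j ! i"
    using j f assms(2) by (simp add: nth_transpose takeWhile_nth)
qed

lemma tableau_transpose:
  assumes T: "tableau T" shows "tableau (List.transpose T)"
proof -
  let ?L = "List.transpose T"
  have "?L ! i \<noteq> []" if "i < length ?L" for i
  proof -
    have "T \<noteq> [] \<and> i < length (T ! 0)"
      using that length_transpose_sorted[OF tableau_sorted_rev[OF T]] by (auto split: if_splits)
    then have "T ! 0 \<in> set (filter (\<lambda>ys. i < length ys) T)" by auto
    then have "filter (\<lambda>ys. i < length ys) T \<noteq> []" by (metis empty_iff list.set(1))
    then show ?thesis using that by (simp add: nth_transpose)
  qed
  then have ne: "[] \<notin> set ?L" by (metis in_set_conv_nth)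
  have len: "sorted_wrt (\<ge>) (map length ?L)"
    using sorted_transpose[of T] by (simp add: sorted_wrt_rev)
  have rows: "sorted_wrt (<) r" if r: "r \<in> set ?L" for r
  proof -
    obtain i where i: "i < length ?L" "r = ?L ! i" using r by (metis in_set_conv_nth)
    show ?thesis unfolding sorted_wrt_iff_nth_less
    proof (intro allI impI)
      fix j k assume "j < k" "k < length r"
      then show "r ! j < r ! k"
        using transpose_tableau_nth[OF T i(1)] tableau_column_less[OF T, of j k i] i(2) by simp
    qed
  qed
  have "?L ! i ! j < ?L ! Suc i ! j" if "Suc i < length ?L" "j < length (?L ! Suc i)" for i j
  proof -
    have "length (?L ! Suc i) \<le> length (?L ! i)"
      using len that(1) by (auto simp: sorted_wrt_iff_nth_less)
    then have "?L ! i ! j = T ! j ! i" using transpose_tableau_nth[OF T, of i j] that by auto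
    moreover have "?L ! Suc i ! j = T ! j ! Suc i" "Suc i < length (T ! j)" "j < length T"
      using transpose_tableau_nth[OF T that] by auto
    moreover have "sorted_wrt (<) (T ! j)" using T \<open>j < length T\<close> by (auto simp: tableau_def)
    ultimately show ?thesis by (simp add: sorted_wrt_iff_nth_less)
  qed
  then show ?thesis using ne len rows by (simp add: tableau_def)
qed

text \<open>The column word, columns from left to right and each from bottom to top, is written as
  the reversal of the row reading word of the transpose. This form makes \<open>knuth_rev\<close>
  applicable later.\<close>

lemma insertion_tableau_column_word:
  assumes "tableau T"
  shows "insertion_tableau (rev (concat (rev (List.transpose T)))) = T"
  using insertion_tableau_columns[OF tableau_transpose[OF assms]] transpose_transpose_tableau[OF assms]
  by (simp add: rev_concat rev_map)

text \<open>Insertion preserves the multiset of letters and turns the column word, which has the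
  letters of the transpose, into \<open>T\<close>.\<close>

lemma mset_transpose:
  assumes "tableau T"
  shows "mset (concat (List.transpose T)) = mset (concat T)"
  using mset_insertion_tableau[of "rev (concat (rev (List.transpose T)))"]
  unfolding insertion_tableau_column_word[OF assms]
  by (simp add: mset_concat rev_map[symmetric] sum_list_rev)

text \<open>Every duplicate-free word is equivalent to the row reading word of its insertion
  tableau, and for the column word this tableau is \<open>T\<close> itself.\<close>

lemma knuth_column_word:
  assumes "tableau T" "distinct (concat T)"
  shows "knuth (rev (concat (rev (List.transpose T)))) (concat (rev T))"
proof -
  have "distinct (rev (concat (rev (List.transpose T))))"
    using assms mset_insertion_tableau[of "rev (concat (rev (List.transpose T)))"]
    unfolding insertion_tableau_column_word[OF assms(1)] by (metis mset_eq_imp_distinct_iff)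
  then show ?thesis
    using tableau_insertion_tableau insertion_tableau_column_word[OF assms(1)] by metis
qed

text \<open>Row insertion into the transpose appends \<open>x\<close> to the reading word of the
  transpose. Reversal turns that word into the column word of \<open>T\<close> and the appended
  letter into a leading one; \<open>knuth_column_word\<close> leads back to row reading words on
  both sides.\<close>

lemma col_insert_tableau:
  assumes T: "tableau T" "distinct (concat T)" and x: "x \<notin> set (concat T)"
  shows "tableau (col_insert x T)" "mset (concat (col_insert x T)) = add_mset x (mset (concat T))"
    and "knuth (x # concat (rev T)) (concat (rev (col_insert x T)))"
proof -
  let ?L = "List.transpose T" and ?T' = "col_insert x T"
  have L: "tableau ?L" "distinct (concat ?L)" "x \<notin> set (concat ?L)"
    using tableau_transpose[OF T(1)] T(2) x mset_transpose[OF T(1)]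
    by (auto dest: mset_eq_setD mset_eq_imp_distinct_iff simp del: mset_concat set_concat)
  then have R: "tableau (row_insert ?L x)" by (rule tableau_row_insert)
  then show T': "tableau ?T'" unfolding col_insert_def by (rule tableau_transpose)
  have tr: "List.transpose ?T' = row_insert ?L x"
    unfolding col_insert_def by (rule transpose_transpose_tableau[OF R])
  show m: "mset (concat ?T') = add_mset x (mset (concat T))"
    using mset_transpose[OF T'] mset_transpose[OF T(1)] mset_row_insert[of ?L x] tr
    by (simp del: mset_concat)
  have "mset (concat ?T') = mset (x # concat T)" using m by (simp del: mset_concat)
  then have d: "distinct (concat ?T')"
    using T x by (metis mset_eq_imp_distinct_iff distinct.simps(2))
  have "knuth (x # concat (rev T)) (x # rev (concat (rev ?L)))"
    using knuth_appendI2[OF knuth_sym[OF knuth_column_word[OF T]], of "[x]"] by simp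
  also have "knuth (x # rev (concat (rev ?L))) (rev (concat (rev (row_insert ?L x))))"
    using knuth_rev[OF knuth_row_insert[OF L]] by simp
  also have "knuth \<dots> (concat (rev ?T'))"
    using knuth_column_word[OF T' d] tr by simp
  finally show "knuth (x # concat (rev T)) (concat (rev ?T'))" .
qed

section \<open>Polynomial maps and Zariski closures\<close>

lemma mult_mat_entry:
  assumes "A \<in> carrier_mat n m" "B \<in> carrier_mat m l" "i < n" "j < l"
  shows "(A * B) $$ (i, j) = (\<Sum>k<m. A $$ (i, k) * B $$ (k, j))"
  using assms by (simp add: scalar_prod_def lessThan_atLeast0)

text \<open>Matrix operations behave as polynomials only on matrices of the right size, while
  elements of \<open>poly_funs\<close> are functions on matrices of all sizes. Hence agreement is
  asked on \<open>carrier_mat n n\<close> only.\<close>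

definition poly_on :: "nat \<Rightarrow> (complex mat \<Rightarrow> complex) \<Rightarrow> bool" where
  "poly_on n f \<longleftrightarrow> (\<exists>p\<in>poly_funs n. \<forall>X\<in>carrier_mat n n. f X = p X)"

lemma poly_on_cong:
  "poly_on n f \<Longrightarrow> (\<And>X. X \<in> carrier_mat n n \<Longrightarrow> f X = g X) \<Longrightarrow> poly_on n g"
  by (auto simp: poly_on_def)

lemma poly_on_poly_funs: "p \<in> poly_funs n \<Longrightarrow> poly_on n p"
  by (auto simp: poly_on_def)

lemma poly_on_const: "poly_on n (\<lambda>X. c)"
  by (intro poly_on_poly_funs poly_funs.const)

lemma poly_on_coord: "i < n \<Longrightarrow> j < n \<Longrightarrow> poly_on n (\<lambda>X. X $$ (i, j))"
  by (intro poly_on_poly_funs poly_funs.coord)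

lemma poly_on_add:
  assumes "poly_on n f" "poly_on n g" shows "poly_on n (\<lambda>X. f X + g X)"
proof -
  obtain p q where "p \<in> poly_funs n" "\<forall>X\<in>carrier_mat n n. f X = p X"
    "q \<in> poly_funs n" "\<forall>X\<in>carrier_mat n n. g X = q X"
    using assms by (auto simp: poly_on_def)
  then show ?thesis using poly_funs.add[of p n q] by (auto simp: poly_on_def)
qed

lemma poly_on_mult:
  assumes "poly_on n f" "poly_on n g" shows "poly_on n (\<lambda>X. f X * g X)"
proof -
  obtain p q where "p \<in> poly_funs n" "\<forall>X\<in>carrier_mat n n. f X = p X"
    "q \<in> poly_funs n" "\<forall>X\<in>carrier_mat n n. g X = q X"
    using assms by (auto simp: poly_on_def)
  then show ?thesis using poly_funs.mult[of p n q] by (auto simp: poly_on_def)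
qed

lemma poly_on_sum: "(\<And>i. i \<in> I \<Longrightarrow> poly_on n (f i)) \<Longrightarrow> poly_on n (\<lambda>X. \<Sum>i\<in>I. f i X)"
  by (induction I rule: infinite_finite_induct) (auto intro: poly_on_const poly_on_add)

lemma poly_on_prod: "(\<And>i. i \<in> I \<Longrightarrow> poly_on n (f i)) \<Longrightarrow> poly_on n (\<lambda>X. \<Prod>i\<in>I. f i X)"
  by (induction I rule: infinite_finite_induct) (auto intro: poly_on_const poly_on_mult)

definition poly_map :: "nat \<Rightarrow> nat \<Rightarrow> (complex mat \<Rightarrow> complex mat) \<Rightarrow> bool" where
  "poly_map n m \<phi> \<longleftrightarrow> (\<forall>X\<in>carrier_mat n n. \<phi> X \<in> carrier_mat m m) \<and>
     (\<forall>i<m. \<forall>j<m. poly_on n (\<lambda>X. \<phi> X $$ (i, j)))"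

lemma poly_mapD:
  "poly_map n m \<phi> \<Longrightarrow> X \<in> carrier_mat n n \<Longrightarrow> \<phi> X \<in> carrier_mat m m"
  "poly_map n m \<phi> \<Longrightarrow> i < m \<Longrightarrow> j < m \<Longrightarrow> poly_on n (\<lambda>X. \<phi> X $$ (i, j))"
  by (auto simp: poly_map_def)

lemma poly_on_comp:
  assumes "poly_on m f" "poly_map n m \<phi>"
  shows "poly_on n (\<lambda>X. f (\<phi> X))"
proof -
  obtain p where p: "p \<in> poly_funs m" "\<forall>X\<in>carrier_mat m m. f X = p X"
    using assms by (auto simp: poly_on_def)
  from p(1) have "poly_on n (\<lambda>X. p (\<phi> X))"
    by induction (use assms(2) in \<open>auto intro: poly_on_const poly_on_add poly_on_mult poly_mapD\<close>)
  then show ?thesis by (rule poly_on_cong) (use p(2) assms(2) in \<open>auto simp: poly_mapD\<close>)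
qed

lemma poly_map_id: "poly_map n n (\<lambda>X. X)"
  by (auto simp: poly_map_def intro: poly_on_coord)

lemma poly_map_const: "A \<in> carrier_mat m m \<Longrightarrow> poly_map n m (\<lambda>X. A)"
  by (auto simp: poly_map_def intro: poly_on_const)

lemma poly_map_add:
  assumes "poly_map n m \<phi>" "poly_map n m \<psi>"
  shows "poly_map n m (\<lambda>X. \<phi> X + \<psi> X)"
  unfolding poly_map_def
proof (intro conjI allI impI ballI)
  fix i j assume ij: "i < m" "j < m"
  have "poly_on n (\<lambda>X. \<phi> X $$ (i, j) + \<psi> X $$ (i, j))"
    by (rule poly_on_add[OF poly_mapD(2)[OF assms(1) ij] poly_mapD(2)[OF assms(2) ij]])
  then show "poly_on n (\<lambda>X. (\<phi> X + \<psi> X) $$ (i, j))"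
    by (rule poly_on_cong) (use carrier_matD[OF poly_mapD(1)[OF assms(2)]] ij in simp)
next
  fix X :: "complex mat" assume "X \<in> carrier_mat n n"
  then show "\<phi> X + \<psi> X \<in> carrier_mat m m"
    using poly_mapD(1)[OF assms(2)] by (meson add_carrier_mat)
qed

lemma poly_map_mult:
  assumes "poly_map n m \<phi>" "poly_map n m \<psi>"
  shows "poly_map n m (\<lambda>X. \<phi> X * \<psi> X)"
  unfolding poly_map_def
proof (intro conjI allI impI ballI)
  fix i j assume ij: "i < m" "j < m"
  show "poly_on n (\<lambda>X. (\<phi> X * \<psi> X) $$ (i, j))"
  proof (rule poly_on_cong[where f = "\<lambda>X. \<Sum>k<m. \<phi> X $$ (i, k) * \<psi> X $$ (k, j)"])
    show "poly_on n (\<lambda>X. \<Sum>k<m. \<phi> X $$ (i, k) * \<psi> X $$ (k, j))"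
      by (intro poly_on_sum poly_on_mult poly_mapD(2)[OF assms(1)] poly_mapD(2)[OF assms(2)] ij) auto
    show "(\<Sum>k<m. \<phi> X $$ (i, k) * \<psi> X $$ (k, j)) = (\<phi> X * \<psi> X) $$ (i, j)"
      if "X \<in> carrier_mat n n" for X
      using mult_mat_entry[of "\<phi> X" m m "\<psi> X" m i j] ij poly_mapD(1)[OF _ that] assms by simp
  qed
next
  fix X :: "complex mat" assume "X \<in> carrier_mat n n"
  then show "\<phi> X * \<psi> X \<in> carrier_mat m m"
    using poly_mapD(1)[OF assms(1)] poly_mapD(1)[OF assms(2)] by (meson mult_carrier_mat)
qed

lemma poly_map_pow:
  assumes "poly_map n m \<phi>"
  shows "poly_map n m (\<lambda>X. \<phi> X ^\<^sub>m k)"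
proof (induction k)
  case 0
  \<comment> \<open>The identity matrix in the zeroth power has the size of \<open>\<phi> X\<close>,
    so this power is constant on the carrier only.\<close>
  have one: "\<phi> X ^\<^sub>m 0 = 1\<^sub>m m" if "X \<in> carrier_mat n n" for X
    using poly_mapD(1)[OF assms that] by simp
  have "poly_on n (\<lambda>X. (\<phi> X ^\<^sub>m 0) $$ (i, j))" if "i < m" "j < m" for i j
    by (rule poly_on_cong[OF poly_on_const[of n "1\<^sub>m m $$ (i, j)"]]) (simp only: one)
  then show ?case using one by (simp add: poly_map_def)
next
  case (Suc k)
  then show ?case using poly_map_mult[OF Suc assms] by simp
qed

lemma poly_on_det:
  assumes "poly_map n m \<phi>"
  shows "poly_on n (\<lambda>X. det (\<phi> X))"
proof (rule poly_on_cong)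
  show "poly_on n (\<lambda>X. \<Sum>p\<in>{p. p permutes {0..<m}}. signof p * (\<Prod>i = 0..<m. \<phi> X $$ (i, p i)))"
    by (intro poly_on_sum poly_on_mult poly_on_const poly_on_prod poly_mapD(2)[OF assms])
      (auto dest: permutes_in_image)
qed (simp add: det_def'[OF poly_mapD(1)[OF assms]])

lemma poly_funs_line:
  assumes "f \<in> poly_funs n" "\<And>i j. i < n \<Longrightarrow> j < n \<Longrightarrow> \<exists>p. \<forall>t. L t $$ (i, j) = poly p t"
  shows "\<exists>p. \<forall>t. f (L t) = poly p t"
  using assms(1)
proof induction
  case (const c)
  show ?case by (rule exI[of _ "[:c:]"]) simp
next
  case (coord i j)
  then show ?case using assms(2) by simp
next
  case (add f g)
  then show ?case by (metis poly_add)
next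
  case (mult f g)
  then show ?case by (metis poly_mult)
qed

section \<open>Coordinate subspaces and their irreducibility\<close>

definition supp_mats :: "nat \<Rightarrow> (nat \<Rightarrow> nat \<Rightarrow> bool) \<Rightarrow> complex mat set" where
  "supp_mats n P = {X \<in> carrier_mat n n. \<forall>i<n. \<forall>j<n. X $$ (i, j) \<noteq> 0 \<longrightarrow> P i j}"

lemma supp_mats_carrier: "supp_mats n P \<subseteq> carrier_mat n n"
  by (auto simp: supp_mats_def)

lemma zero_supp_mats: "0\<^sub>m n n \<in> supp_mats n P"
  by (auto simp: supp_mats_def)

text \<open>On the line through \<open>X\<close> and \<open>Y\<close>, which stays in the subspace,
  both functions are nonzero polynomials in one variable. Together they have finitely many roots, so
  some parameter avoids all of them.\<close>

lemma supp_mats_irreducible: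
  assumes "poly_on n f" "poly_on n g" "X \<in> supp_mats n P" "Y \<in> supp_mats n P" "f X \<noteq> 0" "g Y \<noteq> 0"
  shows "\<exists>Z\<in>supp_mats n P. f Z \<noteq> 0 \<and> g Z \<noteq> 0"
proof -
  obtain f' g' where f': "f' \<in> poly_funs n" "\<forall>X\<in>carrier_mat n n. f X = f' X"
    and g': "g' \<in> poly_funs n" "\<forall>X\<in>carrier_mat n n. g X = g' X"
    using assms(1,2) by (auto simp: poly_on_def)
  define L where "L t = mat n n (\<lambda>(i, j). X $$ (i, j) + t * (Y $$ (i, j) - X $$ (i, j)))" for t
  have XY: "X \<in> carrier_mat n n" "Y \<in> carrier_mat n n" using assms(3,4) by (auto simp: supp_mats_def)
  have L: "L t \<in> supp_mats n P" for t
  proof -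
    have "X $$ (i, j) = 0 \<and> Y $$ (i, j) = 0" if "i < n" "j < n" "\<not> P i j" for i j
      using assms(3,4) that by (auto simp: supp_mats_def)
    then show ?thesis unfolding supp_mats_def L_def by fastforce
  qed
  have L01: "L 0 = X" "L 1 = Y" using XY by (auto simp: L_def intro!: eq_matI)
  have line: "\<exists>p. \<forall>t. L t $$ (i, j) = poly p t" if "i < n" "j < n" for i j
    by (rule exI[of _ "[:X $$ (i, j), Y $$ (i, j) - X $$ (i, j):]"]) (use that in \<open>simp add: L_def\<close>)
  obtain p where p: "\<And>t. f' (L t) = poly p t" using poly_funs_line[OF f'(1) line] by auto
  obtain q where q: "\<And>t. g' (L t) = poly q t" using poly_funs_line[OF g'(1) line] by auto
  have "p \<noteq> 0" using p[of 0] L01 assms(5) f' XY by auto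
  moreover have "q \<noteq> 0" using q[of 1] L01 assms(6) g' XY by auto
  ultimately have "finite {t. poly (p * q) t = 0}" by (intro poly_roots_finite) simp
  then have "{t. poly (p * q) t = 0} \<noteq> UNIV" using infinite_UNIV_char_0[where 'a = complex] by metis
  then obtain t where "poly (p * q) t \<noteq> 0" by blast
  then have "f' (L t) \<noteq> 0" "g' (L t) \<noteq> 0" using p q by auto
  moreover have "L t \<in> carrier_mat n n" using L supp_mats_carrier by blast
  ultimately show ?thesis using L[of t] f'(2) g'(2) by metis
qed

lemma supp_mats_irreducible_finite:
  assumes "finite I" "\<And>i. i \<in> I \<Longrightarrow> poly_on n (f i)" "\<And>i. i \<in> I \<Longrightarrow> \<exists>X\<in>supp_mats n P. f i X \<noteq> 0"
  shows "\<exists>Z\<in>supp_mats n P. \<forall>i\<in>I. f i Z \<noteq> 0"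
proof -
  have "\<exists>Z\<in>supp_mats n P. (\<Prod>i\<in>I. f i Z) \<noteq> 0"
    using assms
  proof (induction I rule: finite_induct)
    case empty
    then show ?case using zero_supp_mats by auto
  next
    case (insert i I)
    then obtain X Y where "X \<in> supp_mats n P" "f i X \<noteq> 0" "Y \<in> supp_mats n P" "(\<Prod>i\<in>I. f i Y) \<noteq> 0"
      by blast
    then have "\<exists>Z\<in>supp_mats n P. f i Z \<noteq> 0 \<and> (\<Prod>i\<in>I. f i Z) \<noteq> 0"
      by (intro supp_mats_irreducible poly_on_prod) (use insert.prems in auto)
    then show ?case using insert.hyps by auto
  qed
  then show ?thesis using assms(1) by auto
qed

lemma zariski_closure_mono: "M \<subseteq> K \<Longrightarrow> zariski_closure n M \<subseteq> zariski_closure n K"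
  by (auto simp: zariski_closure_def)

lemma zariski_closure_subset_sl: "zariski_closure n M \<subseteq> sl n"
  by (auto simp: zariski_closure_def)

lemma sl_carrier: "sl n \<subseteq> carrier_mat n n"
  by (auto simp: sl_def)

lemma subset_zariski_closure: "M \<subseteq> sl n \<Longrightarrow> M \<subseteq> zariski_closure n M"
  by (auto simp: zariski_closure_def)

lemma zariski_closure_minimal:
  "M \<subseteq> zariski_closure n K \<Longrightarrow> zariski_closure n M \<subseteq> zariski_closure n K"
  by (auto simp: zariski_closure_def subset_iff)

lemma zariski_closure_poly_on:
  assumes "X \<in> zariski_closure n M" "poly_on n f" "M \<subseteq> carrier_mat n n" "\<And>Y. Y \<in> M \<Longrightarrow> f Y = 0"
  shows "f X = 0"
proof -
  obtain p where "p \<in> poly_funs n" "\<forall>X\<in>carrier_mat n n. f X = p X"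
    using assms(2) by (auto simp: poly_on_def)
  moreover have "X \<in> carrier_mat n n" using assms(1) zariski_closure_subset_sl sl_carrier by blast
  ultimately show ?thesis using assms by (auto simp: zariski_closure_def subset_iff)
qed

text \<open>Polynomials vanishing on \<open>K\<close> pull back along \<open>\<phi>\<close> to
  polynomials vanishing on \<open>M\<close>. Membership of the image in \<open>sl m\<close> is asked
  separately because closures are formed inside \<open>sl m\<close>.\<close>

lemma zariski_closure_poly_map:
  assumes "poly_map n m \<phi>" "M \<subseteq> carrier_mat n n" "\<And>Y. Y \<in> M \<Longrightarrow> \<phi> Y \<in> zariski_closure m K"
    and "X \<in> zariski_closure n M" "\<phi> X \<in> sl m"
  shows "\<phi> X \<in> zariski_closure m K"
proof -
  have "f (\<phi> X) = 0" if f: "f \<in> poly_funs m" "\<forall>Y\<in>K. f Y = 0" for f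
  proof (rule zariski_closure_poly_on[OF assms(4) _ assms(2)])
    show "poly_on n (\<lambda>X. f (\<phi> X))" by (rule poly_on_comp[OF poly_on_poly_funs[OF f(1)] assms(1)])
    show "f (\<phi> Y) = 0" if "Y \<in> M" for Y
      using assms(3)[OF that] f by (auto simp: zariski_closure_def)
  qed
  then show ?thesis using assms(5) by (auto simp: zariski_closure_def)
qed

text \<open>A polynomial \<open>h\<close> that vanishes on the open part but not at \<open>X\<close>
  would contradict irreducibility: some point would satisfy all conditions and have \<open>h\<close>
  nonzero.\<close>

lemma supp_mats_dense:
  assumes "supp_mats n P \<subseteq> sl n" "finite I" "\<And>i. i \<in> I \<Longrightarrow> poly_on n (f i)"
    "\<And>i. i \<in> I \<Longrightarrow> \<exists>X\<in>supp_mats n P. f i X \<noteq> 0"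
  shows "supp_mats n P \<subseteq> zariski_closure n {X \<in> supp_mats n P. \<forall>i\<in>I. f i X \<noteq> 0}"
proof
  fix X assume X: "X \<in> supp_mats n P"
  have "h X = 0" if h: "h \<in> poly_funs n" "\<forall>Y\<in>{X \<in> supp_mats n P. \<forall>i\<in>I. f i X \<noteq> 0}. h Y = 0" for h
  proof (rule ccontr)
    assume "h X \<noteq> 0"
    obtain Y where "Y \<in> supp_mats n P" "\<forall>i\<in>I. f i Y \<noteq> 0"
      using supp_mats_irreducible_finite[of I n f P] assms(2-4) by blast
    then have "\<exists>Z\<in>supp_mats n P. h Z \<noteq> 0 \<and> (\<Prod>i\<in>I. f i Z) \<noteq> 0"
      using X \<open>h X \<noteq> 0\<close> assms(2)
      by (intro supp_mats_irreducible[of n h _ X P Y] poly_on_prod assms(3) poly_on_poly_funs h(1)) auto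
    then show False using h(2) assms(2) by auto
  qed
  then show "X \<in> zariski_closure n {X \<in> supp_mats n P. \<forall>i\<in>I. f i X \<noteq> 0}"
    using X assms(1) by (auto simp: zariski_closure_def)
qed

section \<open>Saturation under conjugation\<close>

lemma trace_mult_commute:
  fixes A B :: "'a::comm_semiring_0 mat"
  assumes "A \<in> carrier_mat n n" "B \<in> carrier_mat n n"
  shows "(\<Sum>i<n. (A * B) $$ (i, i)) = (\<Sum>i<n. (B * A) $$ (i, i))"
proof -
  have "(\<Sum>i<n. (A * B) $$ (i, i)) = (\<Sum>i<n. \<Sum>k<n. A $$ (i, k) * B $$ (k, i))"
    using mult_mat_entry[OF assms] by simp
  also have "\<dots> = (\<Sum>k<n. \<Sum>i<n. A $$ (i, k) * B $$ (k, i))" by (rule sum.swap)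
  also have "\<dots> = (\<Sum>k<n. (B * A) $$ (k, k))"
    using mult_mat_entry[OF assms(2,1)] by (simp add: mult.commute)
  finally show ?thesis .
qed

lemma similar_mat_wit_sl:
  assumes "similar_mat_wit Y X g h" "X \<in> sl n"
  shows "Y \<in> sl n"
proof -
  have X: "X \<in> carrier_mat n n" using assms(2) by (auto simp: sl_def)
  have "dim_row Y = n"
    using similar_mat_witD[OF refl assms(1)] X by (metis carrier_matD(1))
  note w = similar_mat_witD[OF this[symmetric] assms(1)]
  have "(\<Sum>i<n. Y $$ (i, i)) = (\<Sum>i<n. (h * (g * X)) $$ (i, i))"
    unfolding w(3) using w by (intro trace_mult_commute) auto
  also have "h * (g * X) = X" using w by (simp add: assoc_mult_mat[symmetric, of h n n g n X n])
  finally show ?thesis using assms(2) w(4) by (auto simp: sl_def)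
qed

lemma conj_sat_sl: "M \<subseteq> sl n \<Longrightarrow> conj_sat H M \<subseteq> sl n"
  by (auto simp: conj_sat_def intro: similar_mat_wit_sl)

lemma subset_conj_sat: "1\<^sub>m n \<in> H \<Longrightarrow> M \<subseteq> carrier_mat n n \<Longrightarrow> M \<subseteq> conj_sat H M"
  using similar_mat_wit_refl[of _ n] unfolding conj_sat_def by blast

lemma conj_sat_mono: "M \<subseteq> K \<Longrightarrow> conj_sat H M \<subseteq> conj_sat H K"
  unfolding conj_sat_def by blast

text \<open>Inverses are supplied by the second witness in \<open>similar_mat_wit\<close>, so the
  closure properties of a monoid express the stability of saturations.\<close>

definition mat_submonoid :: "nat \<Rightarrow> complex mat set \<Rightarrow> bool" where
  "mat_submonoid n H \<longleftrightarrow> H \<subseteq> carrier_mat n n \<and> 1\<^sub>m n \<in> H \<and> (\<forall>g\<in>H. \<forall>h\<in>H. g * h \<in> H)"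

lemma conj_sat_stable:
  assumes "mat_submonoid n H" "X \<in> conj_sat H M" "g \<in> H" "similar_mat_wit Y X g h"
  shows "Y \<in> conj_sat H M"
proof -
  obtain Z g' h' where "Z \<in> M" "g' \<in> H" "similar_mat_wit X Z g' h'"
    using assms(2) by (auto simp: conj_sat_def)
  then show ?thesis
    using similar_mat_wit_trans[OF assms(4), of Z g' h'] assms(1,3)
    unfolding conj_sat_def mat_submonoid_def by blast
qed

text \<open>Conjugation by a fixed \<open>g\<close> is a polynomial map that sends the saturation
  into itself, hence also its closure.\<close>

lemma closure_conj_sat_stable:
  assumes H: "mat_submonoid n H" and M: "M \<subseteq> sl n"
    and X: "X \<in> zariski_closure n (conj_sat H M)" and g: "g \<in> H" "similar_mat_wit Y X g h"
  shows "Y \<in> zariski_closure n (conj_sat H M)"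
proof -
  have Y: "Y \<in> sl n" using similar_mat_wit_sl[OF g(2)] X zariski_closure_subset_sl by blast
  then have "dim_row Y = n" by (auto simp: sl_def)
  note w = similar_mat_witD[OF this[symmetric] g(2)]
  let ?K = "conj_sat H M"
  have K: "?K \<subseteq> sl n" by (rule conj_sat_sl[OF M])
  have "g * X * h \<in> zariski_closure n ?K"
  proof (rule zariski_closure_poly_map[OF _ _ _ X])
    show "poly_map n n (\<lambda>X. g * X * h)"
      using w by (intro poly_map_mult poly_map_const poly_map_id) auto
    show "?K \<subseteq> carrier_mat n n" using K sl_carrier by blast
    fix Z assume Z: "Z \<in> ?K"
    then have "Z \<in> carrier_mat n n" using K sl_carrier by blast
    then have "similar_mat_wit (g * Z * h) Z g h" using w by (intro similar_mat_witI) auto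
    then have "g * Z * h \<in> ?K" using conj_sat_stable[OF H Z g(1)] by blast
    then show "g * Z * h \<in> zariski_closure n ?K" using subset_zariski_closure[OF K] by blast
  qed (use Y w in simp)
  then show ?thesis using w(3) by simp
qed

text \<open>The tool for all inclusions of saturated closures below: it suffices to place the
  generating matrices \<open>M\<close> in the larger closure.\<close>

lemma closure_conj_sat_le:
  assumes "mat_submonoid n H" "K \<subseteq> sl n" "M \<subseteq> zariski_closure n (conj_sat H K)"
  shows "zariski_closure n (conj_sat H M) \<subseteq> zariski_closure n (conj_sat H K)"
proof (rule zariski_closure_minimal)
  show "conj_sat H M \<subseteq> zariski_closure n (conj_sat H K)"
    using closure_conj_sat_stable[OF assms(1,2)] assms(3) by (auto simp: conj_sat_def)
qed

lemma mat_submonoid_SL: "mat_submonoid n (SL n)"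
  by (auto simp: mat_submonoid_def SL_def det_mult)

lemma upper_triangular_mult:
  fixes A B :: "'a::semiring_0 mat"
  assumes "upper_triangular A" "upper_triangular B" "A \<in> carrier_mat n n" "B \<in> carrier_mat n n"
  shows "upper_triangular (A * B)"
proof (rule upper_triangularI)
  fix i j assume ij: "j < i" "i < dim_row (A * B)"
  have "A $$ (i, k) * B $$ (k, j) = 0" if "k < n" for k
    using upper_triangularD[OF assms(1), of k i] upper_triangularD[OF assms(2), of j k]
      assms(3,4) ij that by (cases "k < i") auto
  then show "(A * B) $$ (i, j) = 0" using mult_mat_entry[OF assms(3,4), of i j] ij assms(3) by simp
qed

lemma mat_submonoid_SL_borel: "mat_submonoid n (SL_borel n)"
  unfolding mat_submonoid_def
proof (intro conjI ballI)
  fix g h assume "g \<in> SL_borel n" "h \<in> SL_borel n"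
  then have "g * h \<in> SL n" "upper_triangular (g * h)"
    using mat_submonoid_SL[of n] upper_triangular_mult[of g h n]
    by (simp_all add: mat_submonoid_def SL_borel_def SL_def)
  then show "g * h \<in> SL_borel n" by (simp add: SL_borel_def)
qed (auto simp: SL_borel_def SL_def)

section \<open>Nilpotent matrices and kernel dimensions\<close>

lemma jordan_matrix_append:
  "jordan_matrix (as @ bs) =
    four_block_mat (jordan_matrix as) (0\<^sub>m (sum_list (map fst as)) (sum_list (map fst bs)))
      (0\<^sub>m (sum_list (map fst bs)) (sum_list (map fst as))) (jordan_matrix bs)"
proof -
  have "dim_row (diag_block_mat (map (\<lambda>(n, a). jordan_block n a) cs)) = sum_list (map fst cs)"
    "dim_col (diag_block_mat (map (\<lambda>(n, a). jordan_block n a) cs)) = sum_list (map fst cs)"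
    for cs :: "(nat \<times> 'a) list"
    using jordan_matrix_dim[of cs] by (simp_all add: jordan_matrix_def)
  then show ?thesis by (simp add: jordan_matrix_def diag_block_mat_append Let_def)
qed

lemma similar_mat_four_block_swap:
  fixes A B :: "'a::comm_ring_1 mat"
  assumes "A \<in> carrier_mat n n" "B \<in> carrier_mat m m"
  shows "similar_mat (four_block_mat A (0\<^sub>m n m) (0\<^sub>m m n) B) (four_block_mat B (0\<^sub>m m n) (0\<^sub>m n m) A)"
proof (rule similar_matI)
  let ?P = "four_block_mat (0\<^sub>m n m) (1\<^sub>m n) (1\<^sub>m m) (0\<^sub>m m n) :: 'a mat"
  let ?Q = "four_block_mat (0\<^sub>m m n) (1\<^sub>m m) (1\<^sub>m n) (0\<^sub>m n m) :: 'a mat"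
  let ?AB = "four_block_mat A (0\<^sub>m n m) (0\<^sub>m m n) B"
  let ?BA = "four_block_mat B (0\<^sub>m m n) (0\<^sub>m n m) A"
  have "?P \<in> carrier_mat (n + m) (m + n)" "?Q \<in> carrier_mat (m + n) (n + m)"
    by (intro four_block_carrier_mat; simp)+
  moreover have "?AB \<in> carrier_mat (n + m) (n + m)" "?BA \<in> carrier_mat (m + n) (m + n)"
    using assms by simp_all
  ultimately show "{?AB, ?BA, ?P, ?Q} \<subseteq> carrier_mat (n + m) (n + m)"
    by (simp add: add.commute)
  have PQ: "?P * ?Q = four_block_mat (1\<^sub>m n) (0\<^sub>m n m) (0\<^sub>m m n) (1\<^sub>m m)"
    by (subst mult_four_block_mat[of _ n m _ n _ m _ _ n _ m]) auto
  have QP: "?Q * ?P = four_block_mat (1\<^sub>m m) (0\<^sub>m m n) (0\<^sub>m n m) (1\<^sub>m n)"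
    by (subst mult_four_block_mat[of _ m n _ m _ n _ _ m _ n]) auto
  show "?P * ?Q = 1\<^sub>m (n + m)" unfolding PQ by (rule four_block_one_mat)
  show "?Q * ?P = 1\<^sub>m (n + m)" unfolding QP four_block_one_mat by (simp add: add.commute)
  have "?P * ?BA = four_block_mat (0\<^sub>m n m) A B (0\<^sub>m m n)"
    using assms by (subst mult_four_block_mat[of _ n m _ n _ m _ _ m _ n]) auto
  then show "?AB = ?P * ?BA * ?Q"
    using assms by (simp, subst mult_four_block_mat[of _ n m _ n _ m _ _ n _ m]) auto
qed

lemma similar_jordan_matrix_append:
  fixes as bs cs ds :: "(nat \<times> 'a::comm_ring_1) list"
  assumes "similar_mat (jordan_matrix as) (jordan_matrix bs)"
    and "similar_mat (jordan_matrix cs) (jordan_matrix ds)"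
  shows "similar_mat (jordan_matrix (as @ cs)) (jordan_matrix (bs @ ds))"
proof -
  have "sum_list (map fst as) = sum_list (map fst bs)" "sum_list (map fst cs) = sum_list (map fst ds)"
    using similar_matD[OF assms(1)] similar_matD[OF assms(2)] jordan_matrix_dim
    by (metis carrier_matD(1) insert_subset)+
  then show ?thesis unfolding jordan_matrix_append
    using similar_mat_four_block_0_0[OF assms jordan_matrix_carrier jordan_matrix_carrier] by simp
qed

lemma similar_jordan_matrix_swap:
  fixes as bs :: "(nat \<times> 'a::comm_ring_1) list"
  shows "similar_mat (jordan_matrix (as @ bs)) (jordan_matrix (bs @ as))"
  unfolding jordan_matrix_append by (rule similar_mat_four_block_swap) simp_all

text \<open>Block counts determine a Jordan form only up to the order of its blocks; block
  permutations remove this ambiguity.\<close>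

lemma similar_jordan_matrix_mset:
  fixes as bs :: "(nat \<times> 'a::comm_ring_1) list"
  shows "mset as = mset bs \<Longrightarrow> similar_mat (jordan_matrix as) (jordan_matrix bs)"
proof (induction as arbitrary: bs)
  case Nil
  then show ?case by (auto intro: similar_mat_refl jordan_matrix_carrier)
next
  case (Cons a as)
  have refl: "similar_mat (jordan_matrix cs) (jordan_matrix cs)" for cs :: "(nat \<times> 'a) list"
    by (rule similar_mat_refl) (rule jordan_matrix_carrier)
  have "a \<in> set bs" using Cons.prems by (metis list.set_intros(1) mset_eq_setD)
  then obtain b1 b2 where bs: "bs = b1 @ a # b2" by (auto dest: split_list)
  then have "similar_mat (jordan_matrix as) (jordan_matrix (b1 @ b2))"
    using Cons by auto
  then have "similar_mat (jordan_matrix (a # as)) (jordan_matrix (a # b1 @ b2))"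
    using similar_jordan_matrix_append[OF refl[of "[a]"]] by fastforce
  moreover have "similar_mat (jordan_matrix (a # b1 @ b2)) (jordan_matrix bs)"
    using similar_jordan_matrix_append[OF similar_jordan_matrix_swap[of "[a]" b1] refl[of b2]] bs
    by simp
  ultimately show ?case by (rule similar_mat_trans)
qed

lemma nilpotent_eigenvalue:
  fixes X :: "complex mat"
  assumes X: "X \<in> carrier_mat n n" "X ^\<^sub>m k = 0\<^sub>m n n" and "eigenvalue X e"
  shows "e = 0"
proof -
  obtain v where v: "eigenvector X v e" using assms(3) by (auto simp: eigenvalue_def)
  then have vn: "v \<in> carrier_vec n" "v \<noteq> 0\<^sub>v n" using X by (auto simp: eigenvector_def)
  have "0\<^sub>m n n *\<^sub>v v = 0\<^sub>v n" using vn by (intro eq_vecI) auto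
  then have "e ^ k \<cdot>\<^sub>v v = 0\<^sub>v n" using eigenvector_pow[OF X(1) v, of k] X(2) by simp
  then have "e ^ k * v $ i = 0" if "i < n" for i
    using that vn by (metis carrier_vecD index_smult_vec(1) index_zero_vec(1))
  moreover obtain i where "i < n" "v $ i \<noteq> 0" using vn by (metis carrier_vecD eq_vecI index_zero_vec)
  ultimately show "e = 0" by fastforce
qed

lemma dim_gen_eigenspace_0:
  "A \<in> carrier_mat n n \<Longrightarrow> dim_gen_eigenspace A 0 k = kernel_dim (A ^\<^sub>m k)"
proof -
  assume A: "A \<in> carrier_mat n n"
  then have "char_matrix A 0 = A" by (auto simp: char_matrix_def intro!: eq_matI)
  then show ?thesis by (simp add: dim_gen_eigenspace_def)
qed

lemma nilpotent_jordan_nf: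
  fixes X :: "complex mat"
  assumes X: "X \<in> carrier_mat n n" "X ^\<^sub>m k = 0\<^sub>m n n"
  obtains as where "jordan_nf X as" "\<And>m e. (m, e) \<in> set as \<Longrightarrow> e = 0 \<and> m \<noteq> 0"
proof -
  obtain es where "char_poly X = (\<Prod>a\<leftarrow>es. [:- a, 1:])" using char_poly_factorized[OF X(1)] by auto
  then obtain as where as: "jordan_nf X as" using jordan_nf_exists[OF X(1)] by blast
  have "e = 0 \<and> m \<noteq> 0" if me: "(m, e) \<in> set as" for m e
  proof
    show m: "m \<noteq> 0" using as me by (force simp: jordan_nf_def)
    \<comment> \<open>A nonempty block forces positive multiplicity, so \<open>e\<close> is a root
      of the characteristic polynomial and thus an eigenvalue.\<close>
    have "m \<le> Polynomial.order e (char_poly X)" by (rule jordan_nf_block_size_order_bound[OF as me])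
    then have "poly (char_poly X) e = 0" using m by (metis le_zero_eq order_0I)
    then show "e = 0" using nilpotent_eigenvalue[OF X] eigenvalue_root_char_poly[OF X(1)] by blast
  qed
  then show ?thesis using that[OF as] by blast
qed

text \<open>Zero is the only eigenvalue, and the number of Jordan blocks of each size is computed
  from the kernel dimensions of the powers. Both Jordan forms therefore have the same
  blocks.\<close>

lemma similar_mat_nilpotentI:
  fixes X Y :: "complex mat"
  assumes X: "X \<in> carrier_mat n n" "X ^\<^sub>m k = 0\<^sub>m n n"
    and Y: "Y \<in> carrier_mat n n" "Y ^\<^sub>m l = 0\<^sub>m n n"
    and dims: "\<And>i. kernel_dim (X ^\<^sub>m i) = kernel_dim (Y ^\<^sub>m i)"
  shows "similar_mat X Y"
proof -
  obtain as where as: "jordan_nf X as" "\<And>m e. (m, e) \<in> set as \<Longrightarrow> e = 0 \<and> m \<noteq> 0"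
    using nilpotent_jordan_nf[OF X] by blast
  obtain bs where bs: "jordan_nf Y bs" "\<And>m e. (m, e) \<in> set bs \<Longrightarrow> e = 0 \<and> m \<noteq> 0"
    using nilpotent_jordan_nf[OF Y] by blast
  have "mset as = mset bs"
  proof (rule multiset_eqI)
    fix me :: "nat \<times> complex"
    obtain m e where me: "me = (m, e)" by force
    show "count (mset as) me = count (mset bs) me"
    proof (cases "e = 0 \<and> m \<noteq> 0")
      case True
      have "dim_gen_eigenspace X 0 i = dim_gen_eigenspace Y 0 i" for i
        using dims[of i] dim_gen_eigenspace_0[OF X(1)] dim_gen_eigenspace_0[OF Y(1)] by simp
      then have "compute_nr_of_jordan_blocks X e m = compute_nr_of_jordan_blocks Y e m"
        using True by (simp add: compute_nr_of_jordan_blocks_def)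
      then have "length (filter ((=) me) as) = length (filter ((=) me) bs)"
        using compute_nr_of_jordan_blocks[OF as(1), of m e] True me
          compute_nr_of_jordan_blocks[OF bs(1), of m e] by simp
      then show ?thesis by (simp add: count_mset count_list_eq_length_filter)
    next
      case False
      then have "me \<notin> set as" "me \<notin> set bs" using as(2) bs(2) me by blast+
      then have "count (mset as) me = 0" "count (mset bs) me = 0"
        by (simp_all only: count_eq_zero_iff set_mset_mset not_False_eq_True)
      then show ?thesis by (rule trans[OF _ sym])
    qed
  qed
  then have "similar_mat (jordan_matrix as) (jordan_matrix bs)" by (rule similar_jordan_matrix_mset)
  then show ?thesis
    using as(1) bs(1) unfolding jordan_nf_def by (blast intro: similar_mat_trans similar_mat_sym)
qed

section \<open>Semicontinuity of kernel dimensions\<close>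

definition diag_idem :: "nat \<Rightarrow> nat set \<Rightarrow> complex mat" where
  "diag_idem n J = mat n n (\<lambda>(i, j). if i = j \<and> i \<in> J then 1 else 0)"

lemma diag_idem_carrier [simp]: "diag_idem n J \<in> carrier_mat n n"
  by (simp add: diag_idem_def)

lemma kernel_dim_echelon:
  fixes A :: "complex mat"
  assumes A: "A \<in> carrier_mat n n" and E: "E = gauss_jordan_single A"
  shows "kernel_dim A = n - card {i. i < n \<and> row E i \<noteq> 0\<^sub>v n}"
  using kernel_dim_code[of A] gauss_jordan_single(2,3)[OF A E[symmetric]] A E
    find_base_vectors(5)[of E n n] by auto

text \<open>The kernel of \<open>A\<close> has dimension at most \<open>d\<close> iff \<open>P A Q\<close> plus a diagonal idempotent of rank at
  most \<open>d\<close> is invertible for some \<open>P\<close> and \<open>Q\<close>; hence \<open>X \<mapsto> dim ker X\<^sup>k\<close> is upper semicontinuous.\<close>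

lemma kernel_dim_test_exists:
  fixes A :: "complex mat"
  assumes A: "A \<in> carrier_mat n n"
  obtains P Q J where "P \<in> carrier_mat n n" "Q \<in> carrier_mat n n" "J \<subseteq> {..<n}" "card J = kernel_dim A"
    "det (P * A * Q + diag_idem n J) \<noteq> 0"
proof -
  define E where "E = gauss_jordan_single A"
  note gj = gauss_jordan_single[OF A E_def[symmetric]]
  obtain P where P: "E = P * A" "P \<in> carrier_mat n n" using gj(4) by auto
  obtain f where "pivot_fun E f n" using gj(2,3) by (auto simp: row_echelon_form_def)
  note piv = pivot_funD[OF carrier_matD(1)[OF gj(2)] this]
  define I where "I = {i. i < n \<and> row E i \<noteq> 0\<^sub>v n}"
  define J where "J = {..<n} - I"
  have f: "f i < n" if "i \<in> I" for i
  proof (rule ccontr)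
    assume "\<not> f i < n"
    then have "row E i = 0\<^sub>v n" using piv(2)[of i] that gj(2) by (auto simp: I_def intro!: eq_vecI)
    then show False using that by (simp add: I_def)
  qed
  \<comment> \<open>Column \<open>j\<close> of \<open>Q\<close> selects the pivot column of row
    \<open>j\<close>, so \<open>E * Q\<close> is the diagonal idempotent of \<open>I\<close>, and
    adding that of the complement \<open>J\<close> gives the identity.\<close>
  define Q where "Q = mat n n (\<lambda>(k, j). if j \<in> I \<and> k = f j then 1 else 0 :: complex)"
  have Q: "Q \<in> carrier_mat n n" by (simp add: Q_def)
  have "E * Q + diag_idem n J = 1\<^sub>m n"
  proof (rule eq_matI)
    fix i j assume ij: "i < dim_row (1\<^sub>m n :: complex mat)" "j < dim_col (1\<^sub>m n :: complex mat)"
    have "(E * Q) $$ (i, j) = (\<Sum>k<n. E $$ (i, k) * Q $$ (k, j))"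
      using mult_mat_entry[OF gj(2) Q] ij by simp
    also have "\<dots> = (\<Sum>k<n. if j \<in> I \<and> k = f j then E $$ (i, k) else 0)"
      using ij by (intro sum.cong) (auto simp: Q_def)
    also have "\<dots> = (if j \<in> I then E $$ (i, f j) else 0)"
      using f[of j] by (cases "j \<in> I") (simp_all add: sum.delta)
    also have "\<dots> = (if j \<in> I \<and> i = j then 1 else 0)"
      using f[of j] piv(4)[of j] piv(5)[of j i] ij by auto
    finally show "(E * Q + diag_idem n J) $$ (i, j) = 1\<^sub>m n $$ (i, j)"
      using ij gj(2) Q by (auto simp: diag_idem_def J_def)
  qed (use gj(2) Q in \<open>auto simp: diag_idem_def\<close>)
  then have "det (P * A * Q + diag_idem n J) \<noteq> 0" using P(1) by (simp add: det_one)
  moreover have "card J = kernel_dim A"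
    using kernel_dim_echelon[OF A E_def] unfolding J_def I_def by (subst card_Diff_subset) auto
  moreover have "J \<subseteq> {..<n}" by (auto simp: J_def)
  ultimately show ?thesis using that P(2) Q by blast
qed

text \<open>If the kernel were larger than \<open>card J\<close>, the nonzero rows of
  \<open>E * Q\<close> and the coordinates in \<open>J\<close> would impose fewer than
  \<open>n\<close> linear conditions. A nonzero \<open>v\<close> satisfying them is annihilated by
  both summands, contrary to invertibility.\<close>

lemma kernel_dim_le_test:
  fixes A :: "complex mat"
  assumes A: "A \<in> carrier_mat n n" and P: "P \<in> carrier_mat n n" and Q: "Q \<in> carrier_mat n n"
    and J: "J \<subseteq> {..<n}" and det: "det (P * A * Q + diag_idem n J) \<noteq> 0"
  shows "kernel_dim A \<le> card J"
proof (rule ccontr)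
  assume less: "\<not> kernel_dim A \<le> card J"
  define E where "E = gauss_jordan_single A"
  note gj = gauss_jordan_single[OF A E_def[symmetric]]
  define I where "I = {i. i < n \<and> row E i \<noteq> 0\<^sub>v n}"
  have fin: "finite I" "finite J" using J finite_subset by (auto simp: I_def)
  define L where "L = map (row (E * Q)) (sorted_list_of_set I) @ map (unit_vec n) (sorted_list_of_set J)"
  have setL: "set L = row (E * Q) ` I \<union> unit_vec n ` J" using fin by (simp add: L_def)
  have EQ: "E * Q \<in> carrier_mat n n" using gj(2) Q by auto
  have "length L = card I + card J" by (simp add: L_def)
  moreover have "kernel_dim A = n - card I" using kernel_dim_echelon[OF A E_def] by (simp add: I_def)
  ultimately have len: "length L < n" using less by simp
  \<comment> \<open>Zero rows pad the conditions in \<open>L\<close> to a square matrix, whose last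
    row vanishes, so that a nonzero solution comes from a vanishing determinant.\<close>
  define N where "N = mat n n (\<lambda>(i, j). if i < length L then (L ! i) $ j else 0)"
  have N: "N \<in> carrier_mat n n" by (simp add: N_def)
  have "det N = 0"
  proof -
    have "N $$ (n - 1, j) = 0" if "j < n" for j using that len by (simp add: N_def)
    then show ?thesis using laplace_expansion_row[OF N, of "n - 1"] len by simp
  qed
  then obtain v where v: "v \<in> carrier_vec n" "v \<noteq> 0\<^sub>v n" "N *\<^sub>v v = 0\<^sub>v n"
    using det_0_iff_vec_prod_zero_field[OF N] by auto
  have L0: "u \<bullet> v = 0" if u: "u \<in> set L" for u
  proof -
    obtain i where i: "i < length L" "u = L ! i" using u by (metis in_set_conv_nth)
    have "u \<in> carrier_vec n" using u row_carrier_vec[OF _ EQ] unfolding setL I_def by auto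
    then have "row N i = u" using i len by (auto simp: N_def)
    moreover have "(N *\<^sub>v v) $ i = row N i \<bullet> v" using i len N by simp
    ultimately show ?thesis using v(3) i len by simp
  qed
  have "(E * Q) *\<^sub>v v = 0\<^sub>v n"
  proof (rule eq_vecI)
    fix i assume "i < dim_vec (0\<^sub>v n :: complex vec)"
    then have i: "i < n" by simp
    have "row (E * Q) i \<bullet> v = 0"
    proof (cases "i \<in> I")
      case True
      then show ?thesis using L0 setL by blast
    next
      case False
      then have "row E i = 0\<^sub>v n" using i by (simp add: I_def)
      then have "row (E * Q) i = 0\<^sub>v n" using i gj(2) Q by (auto intro!: eq_vecI)
      then show ?thesis using v(1) by simp
    qed
    then show "((E * Q) *\<^sub>v v) $ i = 0\<^sub>v n $ i" using i gj(2) by simp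
  qed (use gj(2) in simp)
  then have "E *\<^sub>v (Q *\<^sub>v v) = 0\<^sub>v n" using gj(2) Q v(1) by (metis assoc_mult_mat_vec)
  then have AQ: "A *\<^sub>v (Q *\<^sub>v v) = 0\<^sub>v n" using gj(1)[of "Q *\<^sub>v v"] Q v(1) by simp
  have PAQ: "P * A * Q \<in> carrier_mat n n" using P A Q by auto
  have "(P * A * Q) *\<^sub>v v = P *\<^sub>v (A *\<^sub>v (Q *\<^sub>v v))"
    using P A Q v(1) by (simp add: assoc_mult_mat_vec[of _ n n _ n])
  also have "\<dots> = 0\<^sub>v n" using P by (simp add: AQ) (intro eq_vecI; simp)
  finally have 1: "(P * A * Q) *\<^sub>v v = 0\<^sub>v n" .
  have "diag_idem n J *\<^sub>v v = 0\<^sub>v n"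
  proof (rule eq_vecI)
    fix i assume "i < dim_vec (0\<^sub>v n :: complex vec)"
    then have i: "i < n" by simp
    have "row (diag_idem n J) i = (if i \<in> J then unit_vec n i else 0\<^sub>v n)"
      using i by (auto simp: diag_idem_def unit_vec_def intro!: eq_vecI)
    then have "row (diag_idem n J) i \<bullet> v = 0"
      using L0[of "unit_vec n i"] setL v(1) by auto
    then show "(diag_idem n J *\<^sub>v v) $ i = 0\<^sub>v n $ i" using i by (simp add: diag_idem_def)
  qed (simp add: diag_idem_def)
  then have "(P * A * Q + diag_idem n J) *\<^sub>v v = 0\<^sub>v n"
    using 1 v(1) PAQ by (simp add: add_mult_distrib_mat_vec)
  then have "det (P * A * Q + diag_idem n J) = 0"
    using det_0_iff_vec_prod_zero_field[of "P * A * Q + diag_idem n J" n] v PAQ by auto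
  then show False using det by simp
qed

text \<open>\<open>f\<close> is the determinant test belonging to \<open>A\<close>. It is evaluated
  at \<open>X ^\<^sub>m k\<close>, so its nonvanishing is an open condition on \<open>X\<close>
  itself.\<close>

lemma kernel_dim_test:
  assumes "A \<in> carrier_mat n n"
  obtains f where "poly_on n (\<lambda>X. f (X ^\<^sub>m k))" "f A \<noteq> 0"
    "\<And>B. B \<in> carrier_mat n n \<Longrightarrow> f B \<noteq> 0 \<Longrightarrow> kernel_dim B \<le> kernel_dim A"
proof -
  obtain P Q J where *: "P \<in> carrier_mat n n" "Q \<in> carrier_mat n n" "J \<subseteq> {..<n}" "card J = kernel_dim A"
    "det (P * A * Q + diag_idem n J) \<noteq> 0"
    using kernel_dim_test_exists[OF assms] by blast
  have "poly_map n n (\<lambda>X. P * X ^\<^sub>m k * Q + diag_idem n J)"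
    by (intro poly_map_add poly_map_mult poly_map_pow poly_map_id poly_map_const *) simp
  then have "poly_on n (\<lambda>X. det (P * X ^\<^sub>m k * Q + diag_idem n J))" by (rule poly_on_det)
  then show ?thesis using that[of "\<lambda>B. det (P * B * Q + diag_idem n J)"] * kernel_dim_le_test by metis
qed

lemma strictly_upper_pow:
  fixes X :: "'a::comm_ring_1 mat"
  assumes X: "X \<in> carrier_mat n n" "\<And>i j. i < n \<Longrightarrow> j < n \<Longrightarrow> X $$ (i, j) \<noteq> 0 \<Longrightarrow> i < j"
  shows "i < n \<Longrightarrow> j < n \<Longrightarrow> (X ^\<^sub>m k) $$ (i, j) \<noteq> 0 \<Longrightarrow> i + k \<le> j"
proof (induction k arbitrary: j)
  case 0
  then show ?case using X by (auto split: if_splits)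
next
  case (Suc k)
  have "(X ^\<^sub>m Suc k) $$ (i, j) = (\<Sum>l<n. (X ^\<^sub>m k) $$ (i, l) * X $$ (l, j))"
    using mult_mat_entry[of "X ^\<^sub>m k" n n X n i j] X(1) Suc.prems by simp
  then obtain l where l: "l < n" "(X ^\<^sub>m k) $$ (i, l) * X $$ (l, j) \<noteq> 0"
    using Suc.prems(3) sum.neutral[of "{..<n}"] by (metis (no_types, lifting) lessThan_iff)
  then have "(X ^\<^sub>m k) $$ (i, l) \<noteq> 0" "X $$ (l, j) \<noteq> 0" by auto
  then show ?case using Suc.IH[OF Suc.prems(1) l(1)] X(2)[OF l(1) Suc.prems(2)] by simp
qed

lemma strictly_upper_nilpotent:
  fixes X :: "'a::comm_ring_1 mat"
  assumes X: "X \<in> carrier_mat n n" "\<And>i j. i < n \<Longrightarrow> j < n \<Longrightarrow> X $$ (i, j) \<noteq> 0 \<Longrightarrow> i < j"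
    and "n \<le> k"
  shows "X ^\<^sub>m k = 0\<^sub>m n n"
proof (rule eq_matI)
  fix i j assume "i < dim_row (0\<^sub>m n n :: 'a mat)" "j < dim_col (0\<^sub>m n n :: 'a mat)"
  then show "(X ^\<^sub>m k) $$ (i, j) = 0\<^sub>m n n $$ (i, j)"
    using strictly_upper_pow[OF X, where k = k] assms(3) by fastforce
qed (use X in \<open>auto simp: pow_mat_dim\<close>)

section \<open>The generic orbit of a strictly upper triangular subspace\<close>

lemma supp_mats_sl:
  assumes "\<And>i j. P i j \<Longrightarrow> i < j"
  shows "supp_mats n P \<subseteq> sl n"
proof
  fix X assume "X \<in> supp_mats n P"
  then have X: "X \<in> carrier_mat n n" "\<And>i. i < n \<Longrightarrow> X $$ (i, i) = 0"
    using assms by (auto simp: supp_mats_def)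
  then show "X \<in> sl n" by (simp add: sl_def)
qed

text \<open>Each exponent \<open>k\<close> has its own minimiser \<open>M k\<close>. The test at
  \<open>M k\<close> cuts out an open set on which the minimum is attained, and irreducibility makes
  the intersection of finitely many of these sets dense.\<close>

lemma supp_mats_generic:
  assumes P: "\<And>i j. P i j \<Longrightarrow> i < j"
  obtains X0 where "X0 \<in> supp_mats n P"
    "supp_mats n P \<subseteq> zariski_closure n
      {X \<in> supp_mats n P. \<forall>k. kernel_dim (X ^\<^sub>m k) = kernel_dim (X0 ^\<^sub>m k)}"
proof -
  let ?N = "supp_mats n P"
  have "\<exists>X\<in>?N. \<forall>Y\<in>?N. kernel_dim (X ^\<^sub>m k) \<le> kernel_dim (Y ^\<^sub>m k)" for k
    using ex_has_least_nat[of "\<lambda>X. X \<in> ?N" "0\<^sub>m n n" "\<lambda>X. kernel_dim (X ^\<^sub>m k)"] zero_supp_mats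
    by blast
  then obtain M where M: "\<And>k. M k \<in> ?N" "\<And>k Y. Y \<in> ?N \<Longrightarrow> kernel_dim (M k ^\<^sub>m k) \<le> kernel_dim (Y ^\<^sub>m k)"
    by metis
  have "\<exists>f. poly_on n (\<lambda>X. f (X ^\<^sub>m k)) \<and> f (M k ^\<^sub>m k) \<noteq> 0 \<and>
      (\<forall>B\<in>carrier_mat n n. f B \<noteq> 0 \<longrightarrow> kernel_dim B \<le> kernel_dim (M k ^\<^sub>m k))" for k
    using kernel_dim_test[of "M k ^\<^sub>m k" n k] M(1)[of k] supp_mats_carrier by (metis pow_carrier_mat subsetD)
  then obtain f where f: "\<And>k. poly_on n (\<lambda>X. f k (X ^\<^sub>m k))" "\<And>k. f k (M k ^\<^sub>m k) \<noteq> 0"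
    "\<And>k B. B \<in> carrier_mat n n \<Longrightarrow> f k B \<noteq> 0 \<Longrightarrow> kernel_dim B \<le> kernel_dim (M k ^\<^sub>m k)"
    by metis
  let ?U = "{X \<in> ?N. \<forall>k\<in>{..n}. f k (X ^\<^sub>m k) \<noteq> 0}"
  have test: "\<exists>X\<in>?N. f k (X ^\<^sub>m k) \<noteq> 0" for k using f(2) M(1) by blast
  have dense: "?N \<subseteq> zariski_closure n ?U"
    by (rule supp_mats_dense[OF supp_mats_sl[OF P]]) (use f(1) test in auto)
  have "\<exists>X0\<in>?N. \<forall>k\<in>{..n}. f k (X0 ^\<^sub>m k) \<noteq> 0"
    by (rule supp_mats_irreducible_finite) (use f(1) test in auto)
  then obtain X0 where X0: "X0 \<in> ?U" by auto
  have kd: "kernel_dim (X ^\<^sub>m k) = kernel_dim (M k ^\<^sub>m k)" if "X \<in> ?U" "k \<le> n" for X k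
  proof -
    have "X ^\<^sub>m k \<in> carrier_mat n n" using that supp_mats_carrier by (blast intro: pow_carrier_mat)
    then show ?thesis using f(3)[of "X ^\<^sub>m k" k] M(2)[of X k] that by (simp add: le_antisym)
  qed
  \<comment> \<open>From the exponent \<open>n\<close> on all powers vanish; this is why the tests
    for exponents up to \<open>n\<close> control every exponent.\<close>
  have nil: "X ^\<^sub>m k = 0\<^sub>m n n" if "X \<in> ?U" "n \<le> k" for X k
    by (rule strictly_upper_nilpotent) (use that P in \<open>auto simp: supp_mats_def\<close>)
  have "kernel_dim (X ^\<^sub>m k) = kernel_dim (X0 ^\<^sub>m k)" if "X \<in> ?U" for X k
    using kd[OF that, of k] kd[OF X0, of k] nil[OF that, of k] nil[OF X0, of k] by (cases "k \<le> n") auto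
  then have "?U \<subseteq> {X \<in> ?N. \<forall>k. kernel_dim (X ^\<^sub>m k) = kernel_dim (X0 ^\<^sub>m k)}" by blast
  then show ?thesis using that X0 dense zariski_closure_mono by blast
qed

text \<open>Multiplying the conjugating matrix by an \<open>n\<close>-th root of the inverse of its
  determinant does not change the conjugation. In size 0 every determinant is 1.\<close>

lemma similar_mat_SL:
  assumes "similar_mat Y X" "X \<in> carrier_mat n n"
  shows "\<exists>g\<in>SL n. \<exists>h. similar_mat_wit Y X g h"
proof -
  obtain P Q where PQ: "similar_mat_wit Y X P Q" using assms(1) by (auto simp: similar_mat_def)
  have "dim_row Y = n" using similar_mat_witD[OF refl PQ] assms(2) by (metis carrier_matD(1))
  note w = similar_mat_witD[OF this[symmetric] PQ]
  have det: "det P \<noteq> 0" using w(1) det_mult[OF w(6,7)] by auto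
  obtain c where c: "c ^ n * det P = 1"
  proof (cases "n = 0")
    case True
    then show ?thesis using that[of 1] w(6) by (simp add: det_dim_zero)
  next
    case False
    then obtain c where "c ^ n = 1 / det P" using nth_root_exists[of n "1 / det P"] by auto
    then show ?thesis using that[of c] det by simp
  qed
  show ?thesis
  proof (cases "n = 0")
    case True
    then have "det P = 1" using w(6) by (simp add: det_dim_zero)
    then show ?thesis using PQ w(6) by (auto simp: SL_def)
  next
    case False
    then have c0: "c \<noteq> 0" using c False by (metis mult_zero_left power_0_left zero_neq_one)
    let ?P = "c \<cdot>\<^sub>m P" and ?Q = "inverse c \<cdot>\<^sub>m Q"
    have cancel: "c \<cdot>\<^sub>m (inverse c \<cdot>\<^sub>m A) = A" "inverse c \<cdot>\<^sub>m (c \<cdot>\<^sub>m A) = A" for A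
      using c0 by (auto intro!: eq_matI)
    have PX: "P * X \<in> carrier_mat n n" using w by auto
    have "?P * ?Q = P * Q"
      using mult_smult_assoc_mat[of P n n ?Q n c] mult_smult_distrib[OF w(6,7), of "inverse c"] w cancel
      by simp
    moreover have "?Q * ?P = Q * P"
      using mult_smult_assoc_mat[of Q n n ?P n "inverse c"] mult_smult_distrib[OF w(7,6), of c] w cancel
      by simp
    moreover have "?P * X * ?Q = P * X * Q"
      using mult_smult_assoc_mat[OF w(6,5), of c] mult_smult_assoc_mat[of "P * X" n n ?Q n c]
        mult_smult_distrib[OF PX w(7), of "inverse c"] w PX cancel by simp
    ultimately have "similar_mat_wit Y X ?P ?Q"
      using w c0 by (intro similar_mat_witI[of _ _ n]) auto
    moreover have "?P \<in> SL n" using c w(6) by (auto simp: SL_def)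
    ultimately show ?thesis by blast
  qed
qed

lemma similar_mat_wit_kernel_dim_eq:
  fixes A B :: "complex mat"
  assumes "similar_mat_wit A B P Q"
  shows "kernel_dim A = kernel_dim B"
proof -
  note w = similar_mat_witD[OF refl assms]
  have "kernel.dim (dim_row A) A = kernel.dim (dim_row A) B"
    by (rule similar_mat_wit_kernel_dim[OF w(4) assms])
  then show ?thesis using w(4,5) by (metis kernel_dim_def carrier_matD(2))
qed

text \<open>If the kernel at \<open>X\<close> were smaller, the test belonging to \<open>X\<close>
  would be a polynomial that vanishes on all conjugates of \<open>X0\<close>, where the kernel
  dimension is constant, but not at \<open>X\<close>.\<close>

lemma kernel_dim_le_closure:
  assumes X0: "X0 \<in> sl n" and X: "X \<in> zariski_closure n (conj_sat H {X0})"
  shows "kernel_dim (X0 ^\<^sub>m k) \<le> kernel_dim (X ^\<^sub>m k)"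
proof (rule ccontr)
  assume less: "\<not> ?thesis"
  have K: "conj_sat H {X0} \<subseteq> carrier_mat n n" using conj_sat_sl[of "{X0}" n H] X0 sl_carrier by blast
  have "X ^\<^sub>m k \<in> carrier_mat n n"
    using X zariski_closure_subset_sl sl_carrier by (blast intro: pow_carrier_mat)
  then obtain f where f: "poly_on n (\<lambda>X. f (X ^\<^sub>m k))" "f (X ^\<^sub>m k) \<noteq> 0"
    "\<And>B. B \<in> carrier_mat n n \<Longrightarrow> f B \<noteq> 0 \<Longrightarrow> kernel_dim B \<le> kernel_dim (X ^\<^sub>m k)"
    using kernel_dim_test[of _ n k] by blast
  have "f (Y ^\<^sub>m k) = 0" if Y: "Y \<in> conj_sat H {X0}" for Y
  proof (rule ccontr)
    assume "f (Y ^\<^sub>m k) \<noteq> 0"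
    moreover have "Y ^\<^sub>m k \<in> carrier_mat n n" using Y K by (blast intro: pow_carrier_mat)
    moreover obtain g h where "similar_mat_wit Y X0 g h" using Y by (auto simp: conj_sat_def)
    then have "kernel_dim (Y ^\<^sub>m k) = kernel_dim (X0 ^\<^sub>m k)"
      by (intro similar_mat_wit_kernel_dim_eq[OF similar_mat_wit_pow])
    ultimately show False using f(3) less by fastforce
  qed
  then show False using zariski_closure_poly_on[OF X f(1) K] f(2) by blast
qed

text \<open>Each representative lies in the closure of the other orbit, so the kernel dimensions of
  all powers agree. Used in both directions, this gives uniqueness in the definite description of
  \<open>orbit_of_perm\<close>.\<close>

lemma nilpotent_orbit_subset:
  assumes C: "C \<in> nilpotent_orbits n" and D: "D \<in> nilpotent_orbits n"
    and eq: "zariski_closure n C = zariski_closure n D"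
  shows "C \<subseteq> D"
proof -
  obtain X k where X: "C = conj_sat (SL n) {X}" "X \<in> sl n" "X ^\<^sub>m k = 0\<^sub>m n n"
    using C by (auto simp: nilpotent_orbits_def)
  obtain Y l where Y: "D = conj_sat (SL n) {Y}" "Y \<in> sl n" "Y ^\<^sub>m l = 0\<^sub>m n n"
    using D by (auto simp: nilpotent_orbits_def)
  have XY: "X \<in> carrier_mat n n" "Y \<in> carrier_mat n n" using X Y by (auto simp: sl_def)
  have one: "1\<^sub>m n \<in> SL n" using mat_submonoid_SL by (auto simp: mat_submonoid_def)
  have "X \<in> zariski_closure n C"
    using subset_conj_sat[OF one, of "{X}"] subset_zariski_closure[OF conj_sat_sl[of "{X}" n "SL n"]] X XY
    by auto
  moreover have "Y \<in> zariski_closure n D"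
    using subset_conj_sat[OF one, of "{Y}"] subset_zariski_closure[OF conj_sat_sl[of "{Y}" n "SL n"]] Y XY
    by auto
  ultimately have "kernel_dim (X ^\<^sub>m i) = kernel_dim (Y ^\<^sub>m i)" for i
    using kernel_dim_le_closure[OF X(2), of Y "SL n" i] kernel_dim_le_closure[OF Y(2), of X "SL n" i]
      eq X(1) Y(1) by (simp add: le_antisym)
  then have "similar_mat X Y" by (rule similar_mat_nilpotentI[OF XY(1) X(3) XY(2) Y(3)])
  then have "X \<in> D" using similar_mat_SL[OF _ XY(2)] Y(1) by (auto simp: conj_sat_def)
  then show "C \<subseteq> D"
    using conj_sat_stable[OF mat_submonoid_SL, of X n "{Y}"] X(1) Y(1) by (auto simp: conj_sat_def[of _ "{X}"])
qed

text \<open>The orbit of a generic point \<open>X0\<close> serves. The third claim is stronger than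
  the second: \<open>C\<close> is dense already within the subspace, before any saturation, and so
  remains usable for the Borel group.\<close>

lemma supp_mats_orbit:
  assumes P: "\<And>i j. P i j \<Longrightarrow> i < j"
  obtains C where "C \<in> nilpotent_orbits n"
    "zariski_closure n C = zariski_closure n (conj_sat (SL n) (supp_mats n P))"
    "supp_mats n P \<subseteq> zariski_closure n (supp_mats n P \<inter> C)"
proof -
  let ?N = "supp_mats n P"
  have N: "?N \<subseteq> sl n" by (rule supp_mats_sl[OF P])
  obtain X0 where X0: "X0 \<in> ?N"
    "?N \<subseteq> zariski_closure n {X \<in> ?N. \<forall>k. kernel_dim (X ^\<^sub>m k) = kernel_dim (X0 ^\<^sub>m k)}"
    using supp_mats_generic[OF P] by blast
  have nil: "X \<in> carrier_mat n n \<and> X ^\<^sub>m n = 0\<^sub>m n n" if "X \<in> ?N" for X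
    using strictly_upper_nilpotent[of X n n] P that by (auto simp: supp_mats_def)
  let ?C = "conj_sat (SL n) {X0}"
  have C: "?C \<in> nilpotent_orbits n" using nil[OF X0(1)] N X0(1) by (auto simp: nilpotent_orbits_def)
  have "{X \<in> ?N. \<forall>k. kernel_dim (X ^\<^sub>m k) = kernel_dim (X0 ^\<^sub>m k)} \<subseteq> ?N \<inter> ?C"
  proof safe
    fix X assume X: "X \<in> ?N" "\<forall>k. kernel_dim (X ^\<^sub>m k) = kernel_dim (X0 ^\<^sub>m k)"
    then have "similar_mat X X0" using nil X0(1) by (blast intro: similar_mat_nilpotentI)
    then show "X \<in> ?C" using similar_mat_SL nil[OF X0(1)] by (auto simp: conj_sat_def)
  qed
  then have dense: "?N \<subseteq> zariski_closure n (?N \<inter> ?C)" using X0(2) zariski_closure_mono by blast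
  moreover have "zariski_closure n ?C = zariski_closure n (conj_sat (SL n) ?N)"
  proof
    show "zariski_closure n ?C \<subseteq> zariski_closure n (conj_sat (SL n) ?N)"
      using X0(1) by (intro zariski_closure_mono conj_sat_mono) auto
    have "?N \<subseteq> zariski_closure n ?C" using dense zariski_closure_mono[of "?N \<inter> ?C" ?C n] by blast
    then show "zariski_closure n (conj_sat (SL n) ?N) \<subseteq> zariski_closure n ?C"
      using N X0(1) by (intro closure_conj_sat_le[OF mat_submonoid_SL]) auto
  qed
  ultimately show ?thesis using that C by blast
qed

section \<open>Orbital varieties and closures of Borel saturations\<close>

lemma n_cap_w_supp_mats:
  "n_cap_w n w = supp_mats n (\<lambda>i j. i < j \<and> inv_into UNIV w (Suc i) < inv_into UNIV w (Suc j))"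
  by (simp add: n_cap_w_def supp_mats_def)

text \<open>\<open>C\<close> is stable under conjugation, so the Borel saturation of
  \<open>?N \<inter> C\<close> lies in the orbital variety. As \<open>?N \<inter> C\<close> is dense
  in \<open>?N\<close>, its saturation has the full closure.\<close>

lemma closure_orbital_variety_perm:
  "zariski_closure n (orbital_variety_perm n w) = zariski_closure n (conj_sat (SL_borel n) (n_cap_w n w))"
proof -
  let ?N = "n_cap_w n w" and ?B = "SL_borel n"
  let ?P = "\<lambda>i j. i < j \<and> inv_into UNIV w (Suc i) < inv_into UNIV w (Suc j)"
  obtain C where C: "C \<in> nilpotent_orbits n"
    "zariski_closure n C = zariski_closure n (conj_sat (SL n) ?N)"
    "?N \<subseteq> zariski_closure n (?N \<inter> C)"
    using supp_mats_orbit[of ?P n] unfolding n_cap_w_supp_mats by blast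
  have "orbit_of_perm n w = C"
    unfolding orbit_of_perm_def
  proof (rule the_equality)
    fix D assume "D \<in> nilpotent_orbits n \<and> zariski_closure n D = zariski_closure n (conj_sat (SL n) ?N)"
    then show "D = C" using nilpotent_orbit_subset[of C n D] nilpotent_orbit_subset[of D n C] C by blast
  qed (use C in blast)
  then have V: "orbital_variety_perm n w = zariski_closure n (conj_sat ?B ?N) \<inter> C"
    by (simp add: orbital_variety_perm_def)
  have N: "?N \<subseteq> sl n" unfolding n_cap_w_supp_mats by (rule supp_mats_sl) simp
  have "conj_sat ?B (?N \<inter> C) \<subseteq> orbital_variety_perm n w"
  proof
    fix Y assume "Y \<in> conj_sat ?B (?N \<inter> C)"
    then obtain X g h where Y: "X \<in> ?N" "X \<in> C" "g \<in> ?B" "similar_mat_wit Y X g h"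
      by (auto simp: conj_sat_def)
    have "Y \<in> C"
      using C(1) conj_sat_stable[OF mat_submonoid_SL, of X n _ g Y h] Y
      by (auto simp: nilpotent_orbits_def SL_borel_def)
    moreover have "Y \<in> conj_sat ?B ?N" using Y by (auto simp: conj_sat_def)
    ultimately show "Y \<in> orbital_variety_perm n w"
      using V subset_zariski_closure[OF conj_sat_sl[OF N]] by blast
  qed
  moreover have "?N \<inter> C \<subseteq> conj_sat ?B (?N \<inter> C)"
    using subset_conj_sat[of n ?B "?N \<inter> C"] mat_submonoid_SL_borel[of n] N sl_carrier
    by (fastforce simp: mat_submonoid_def)
  then have "?N \<subseteq> zariski_closure n (conj_sat ?B (?N \<inter> C))"
    using C(3) zariski_closure_mono by blast
  then have "zariski_closure n (conj_sat ?B ?N) \<subseteq> zariski_closure n (conj_sat ?B (?N \<inter> C))"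
    using N by (intro closure_conj_sat_le[OF mat_submonoid_SL_borel]) auto
  ultimately have "zariski_closure n (conj_sat ?B ?N) \<subseteq> zariski_closure n (orbital_variety_perm n w)"
    using zariski_closure_mono by blast
  moreover have "zariski_closure n (orbital_variety_perm n w) \<subseteq> zariski_closure n (conj_sat ?B ?N)"
    unfolding V by (rule zariski_closure_minimal) blast
  ultimately show ?thesis by blast
qed

section \<open>Knuth invariance of the closures\<close>

text \<open>The comparison of positions under the inverse permutation, read off the word; in this
  form it follows Knuth moves and added letters by \<open>before_append\<close>.\<close>

fun before :: "'a list \<Rightarrow> 'a \<Rightarrow> 'a \<Rightarrow> bool" where
  "before [] u v \<longleftrightarrow> False"
| "before (x # xs) u v \<longleftrightarrow> x = u \<and> v \<in> set xs \<or> before xs u v"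

lemma before_append:
  "before (xs @ ys) u v \<longleftrightarrow> before xs u v \<or> before ys u v \<or> u \<in> set xs \<and> v \<in> set ys"
  by (induction xs) auto

lemma before_in_set: "before xs u v \<Longrightarrow> u \<in> set xs \<and> v \<in> set xs"
  by (induction xs) auto

lemma before_map: "inj f \<Longrightarrow> before (map f xs) (f u) (f v) \<longleftrightarrow> before xs u v"
  by (induction xs) (auto simp: inj_eq)

lemma before_word_of_perm:
  "before (word_of_perm n w) u v \<longleftrightarrow> (\<exists>p q. 1 \<le> p \<and> p < q \<and> q \<le> n \<and> w p = u \<and> w q = v)"
proof (induction n)
  case 0
  then show ?case by (auto simp: word_of_perm_def)
next
  case (Suc n)
  have "word_of_perm (Suc n) w = word_of_perm n w @ [w (Suc n)]" by (simp add: word_of_perm_def)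
  moreover have "set (word_of_perm n w) = w ` {1..n}" by (auto simp: word_of_perm_def)
  ultimately have "before (word_of_perm (Suc n) w) u v \<longleftrightarrow>
      (\<exists>p q. 1 \<le> p \<and> p < q \<and> q \<le> n \<and> w p = u \<and> w q = v) \<or> (\<exists>p. 1 \<le> p \<and> p \<le> n \<and> w p = u) \<and> v = w (Suc n)"
    using Suc by (auto simp: before_append)
  also have "\<dots> \<longleftrightarrow> (\<exists>p q. 1 \<le> p \<and> p < q \<and> q \<le> Suc n \<and> w p = u \<and> w q = v)"
    (is "?L \<longleftrightarrow> ?R")
  proof
    assume ?R
    then obtain p q where pq: "1 \<le> p" "p < q" "q \<le> Suc n" "w p = u" "w q = v" by blast
    then show ?L by (cases "q = Suc n") (auto simp: less_Suc_eq_le le_Suc_eq)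
  qed (auto intro: less_Suc_eq_le[THEN iffD2] le_SucI)
  finally show ?case .
qed

text \<open>The space \<open>n_cap_w\<close> attached to a word. The shift by \<open>Suc\<close>
  passes from matrix indices to letters.\<close>

definition word_mats :: "nat \<Rightarrow> nat list \<Rightarrow> complex mat set" where
  "word_mats n xs = supp_mats n (\<lambda>i j. i < j \<and> before xs (Suc i) (Suc j))"

lemma word_mats_sl: "word_mats n xs \<subseteq> sl n"
  unfolding word_mats_def by (rule supp_mats_sl) simp

lemma n_cap_w_word_mats:
  assumes "w permutes {1..n}"
  shows "n_cap_w n w = word_mats n (word_of_perm n w)"
proof -
  have "before (word_of_perm n w) (Suc i) (Suc j) \<longleftrightarrow> inv_into UNIV w (Suc i) < inv_into UNIV w (Suc j)"
    if "i < n" "j < n" for i j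
  proof -
    have "inv_into UNIV w (Suc l) \<in> {1..n}" if "l < n" for l
      using that permutes_in_image[OF permutes_inv[OF assms], of "Suc l"] by simp
    then have "1 \<le> inv_into UNIV w (Suc i)" "inv_into UNIV w (Suc j) \<le> n" using that by auto
    then show ?thesis
      unfolding before_word_of_perm using permutes_inverses[OF assms] by metis
  qed
  then show ?thesis by (auto simp: n_cap_w_def word_mats_def supp_mats_def)
qed

definition borel_closure :: "nat \<Rightarrow> nat list \<Rightarrow> complex mat set" where
  "borel_closure n xs = zariski_closure n (conj_sat (SL_borel n) (word_mats n xs))"

lemma word_mats_subset_borel_closure: "word_mats n xs \<subseteq> borel_closure n xs"
  using subset_zariski_closure[OF conj_sat_sl[OF word_mats_sl]] mat_submonoid_SL_borel[of n]
    subset_conj_sat[of n "SL_borel n" "word_mats n xs"] word_mats_sl sl_carrier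
  unfolding borel_closure_def mat_submonoid_def by blast

section \<open>Knuth moves and transvections\<close>

lemma addrow_mat_SL_borel: "a < b \<Longrightarrow> b < n \<Longrightarrow> addrow_mat n t a b \<in> SL_borel n"
  by (auto simp: SL_borel_def SL_def det_addrow_mat intro!: upper_triangularI)

text \<open>\<open>Y\<close> arises from \<open>X\<close> by adding \<open>t\<close> times row
  \<open>b\<close> to row \<open>a\<close> and then subtracting \<open>t\<close> times column
  \<open>a\<close> from column \<open>b\<close>. The similarity is stated from \<open>X\<close> to
  \<open>Y\<close> because the original matrix is to be exhibited as a conjugate of the reduced
  one.\<close>

lemma transvection_similar:
  fixes X :: "complex mat" and t :: complex
  assumes "a < b" "b < n" "X \<in> carrier_mat n n"
  defines "Y \<equiv> addrow_mat n t a b * X * addrow_mat n (- t) a b"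
  shows "Y \<in> carrier_mat n n" "similar_mat_wit X Y (addrow_mat n (- t) a b) (addrow_mat n t a b)"
    and "i < n \<Longrightarrow> j < n \<Longrightarrow> Y $$ (i, j) = X $$ (i, j) + (if i = a then t * X $$ (b, j) else 0)
      - (if j = b then t * (X $$ (i, a) + (if i = a then t * X $$ (b, a) else 0)) else 0)"
proof -
  let ?g = "addrow_mat n t a b" and ?h = "addrow_mat n (- t) a b"
  have gh: "?g * ?h = 1\<^sub>m n" "?h * ?g = 1\<^sub>m n"
    using addrow_mat_inv[of a n b t] addrow_mat_inv[of a n b "- t"] assms(1,2) by simp_all
  have gX: "?g * X \<in> carrier_mat n n" using assms(3) by auto
  show Y: "Y \<in> carrier_mat n n" unfolding Y_def using gX by auto
  have "similar_mat_wit Y X ?g ?h"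
    by (rule similar_mat_witI[OF gh _ Y assms(3)]) (auto simp: Y_def)
  then show "similar_mat_wit X Y ?h ?g" by (rule similar_mat_wit_sym)
  assume ij: "i < n" "j < n"
  have gX_eq: "(?g * X) $$ (i, l) = X $$ (i, l) + (if i = a then t * X $$ (b, l) else 0)" if "l < n" for l
    by (subst addrow_mat[OF assms(3,2), symmetric]) (use ij that assms(1,3) in auto)
  have "Y $$ (i, j) = (\<Sum>l<n. (?g * X) $$ (i, l) * ?h $$ (l, j))"
    unfolding Y_def using mult_mat_entry[OF gX _ ij] by simp
  also have "\<dots> = (\<Sum>l<n. (if l = j then (?g * X) $$ (i, l) else 0)
      + (if l = a then if j = b then - t * (?g * X) $$ (i, l) else 0 else 0))"
    using ij assms(1) by (intro sum.cong) (auto simp: algebra_simps)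
  also have "\<dots> = (?g * X) $$ (i, j) + (if j = b then - t * (?g * X) $$ (i, a) else 0)"
    using ij assms(1,2) by (simp add: sum.distrib)
  finally show "Y $$ (i, j) = X $$ (i, j) + (if i = a then t * X $$ (b, j) else 0)
      - (if j = b then t * (X $$ (i, a) + (if i = a then t * X $$ (b, a) else 0)) else 0)"
    using gX_eq ij assms(1,2) by simp
qed

text \<open>The matrices with nonzero entry at \<open>(b, c)\<close> are dense in the larger
  subspace, so it is enough to conjugate these into the smaller one.\<close>

lemma closure_conj_supp_mats_eqI:
  assumes P: "\<And>i j. P i j \<Longrightarrow> i < j" and le: "\<And>i j. P' i j \<Longrightarrow> P i j"
    and bc: "P b c" "b < n" "c < n"
    and reduce: "\<And>X. X \<in> supp_mats n P \<Longrightarrow> X $$ (b, c) \<noteq> 0 \<Longrightarrow>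
      \<exists>Y\<in>supp_mats n P'. \<exists>g\<in>SL_borel n. \<exists>h. similar_mat_wit X Y g h"
  shows "zariski_closure n (conj_sat (SL_borel n) (supp_mats n P)) =
    zariski_closure n (conj_sat (SL_borel n) (supp_mats n P'))"
proof
  let ?B = "SL_borel n"
  have sl: "supp_mats n P \<subseteq> sl n" "supp_mats n P' \<subseteq> sl n" using supp_mats_sl P le by blast+
  have "mat n n (\<lambda>(i, j). if i = b \<and> j = c then 1 else 0) \<in> supp_mats n P"
    using bc by (auto simp: supp_mats_def)
  then have "\<exists>X\<in>supp_mats n P. X $$ (b, c) \<noteq> 0" using bc by (intro bexI) auto
  then have "supp_mats n P \<subseteq> zariski_closure n {X \<in> supp_mats n P. \<forall>i\<in>{()}. X $$ (b, c) \<noteq> 0}"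
    by (intro supp_mats_dense[OF sl(1)] poly_on_coord bc) auto
  also have "\<dots> \<subseteq> zariski_closure n (conj_sat ?B (supp_mats n P'))"
    using reduce by (intro zariski_closure_mono) (auto simp: conj_sat_def)
  finally show "zariski_closure n (conj_sat ?B (supp_mats n P)) \<subseteq> zariski_closure n (conj_sat ?B (supp_mats n P'))"
    by (rule closure_conj_sat_le[OF mat_submonoid_SL_borel sl(2)])
  have "supp_mats n P' \<subseteq> supp_mats n P" using le by (auto simp: supp_mats_def)
  then show "zariski_closure n (conj_sat ?B (supp_mats n P')) \<subseteq> zariski_closure n (conj_sat ?B (supp_mats n P))"
    by (intro zariski_closure_mono conj_sat_mono)
qed

text \<open>A Knuth move deletes the single matrix unit \<open>e\<^sub>x\<^sub>z\<close>; conjugation by a transvection clears that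
  entry as soon as the entry at \<open>(y, z)\<close>, respectively \<open>(x, y)\<close>, is nonzero.\<close>

lemma borel_closure_yxz:
  assumes d: "distinct (u @ [Suc y, Suc x, Suc z] @ v)" and xyz: "x < y" "y < z" "z < n"
  shows "borel_closure n (u @ [Suc y, Suc x, Suc z] @ v) = borel_closure n (u @ [Suc y, Suc z, Suc x] @ v)"
  unfolding borel_closure_def word_mats_def
proof (rule closure_conj_supp_mats_eqI)
  let ?w = "u @ [Suc y, Suc x, Suc z] @ v" and ?w' = "u @ [Suc y, Suc z, Suc x] @ v"
  show "i < j \<and> before ?w (Suc i) (Suc j)" if "i < j \<and> before ?w' (Suc i) (Suc j)" for i j
    using that xyz by (auto simp: before_append)
  show "y < z \<and> before ?w (Suc y) (Suc z)" using xyz by (simp add: before_append)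
  fix X assume X: "X \<in> supp_mats n (\<lambda>i j. i < j \<and> before ?w (Suc i) (Suc j))" "X $$ (y, z) \<noteq> 0"
  have Xc: "X \<in> carrier_mat n n"
    and X0: "\<And>i j. i < n \<Longrightarrow> j < n \<Longrightarrow> X $$ (i, j) \<noteq> 0 \<Longrightarrow> i < j \<and> before ?w (Suc i) (Suc j)"
    using X by (auto simp: supp_mats_def)
  \<comment> \<open>The row operation changes the entry at \<open>(x, z)\<close> to
    \<open>X $$ (x, z) + t * X $$ (y, z)\<close>, which this \<open>t\<close> makes zero.\<close>
  define t where "t = - X $$ (x, z) / X $$ (y, z)"
  define Y where "Y = addrow_mat n t x y * X * addrow_mat n (- t) x y"
  have yn: "y < n" using xyz by simp
  note Y = transvection_similar[OF xyz(1) yn Xc, where t = t, folded Y_def]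
  \<comment> \<open>Row \<open>x\<close> receives row \<open>y\<close>: apart from the cleared
    column \<open>z\<close>, its columns belong to letters in \<open>v\<close>, which follow both.
    Column \<open>y\<close> receives column \<open>x\<close>: its rows belong to smaller letters in
    \<open>u\<close>, which precede both.\<close>
  have "i < j \<and> before ?w' (Suc i) (Suc j)" if ij: "i < n" "j < n" "Y $$ (i, j) \<noteq> 0" for i j
  proof (cases "i = x \<or> j = y")
    case False
    then have "X $$ (i, j) \<noteq> 0" "(i, j) \<noteq> (x, z)" using Y(3)[OF ij(1,2)] ij(3) by auto
    then show ?thesis using X0[OF ij(1,2)] False d by (auto simp: before_append dest: before_in_set)
  next
    case True
    have "X $$ (x, y) = 0" "X $$ (x, x) = 0" "X $$ (y, y) = 0" "X $$ (y, x) = 0"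
      using X0[of x y] X0[of x x] X0[of y y] X0[of y x] xyz d
      by (auto simp: before_append dest: before_in_set)
    then consider "i = x" "j \<noteq> y" | "i \<noteq> x" "j = y"
      using True Y(3)[OF ij(1,2)] ij(3) by (auto split: if_splits)
    then show ?thesis
    proof cases
      case 1
      then have Yij: "Y $$ (i, j) = X $$ (x, j) + t * X $$ (y, j)" using Y(3)[OF ij(1,2)] by simp
      then have "j \<noteq> z" using ij(3) X(2) by (auto simp: t_def)
      moreover have "X $$ (x, j) \<noteq> 0 \<or> X $$ (y, j) \<noteq> 0" using Yij ij(3) by auto
      ultimately show ?thesis using X0[of x j] X0[of y j] 1 xyz ij d
        by (auto simp: before_append dest: before_in_set)
    next
      case 2
      then have "X $$ (i, y) \<noteq> 0 \<or> X $$ (i, x) \<noteq> 0" using Y(3)[OF ij(1,2)] ij(3) by auto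
      then show ?thesis using X0[of i y] X0[of i x] 2 xyz ij d
        by (auto simp: before_append dest: before_in_set)
    qed
  qed
  then have "Y \<in> supp_mats n (\<lambda>i j. i < j \<and> before ?w' (Suc i) (Suc j))"
    using Y(1) by (auto simp: supp_mats_def)
  then show "\<exists>Y\<in>supp_mats n (\<lambda>i j. i < j \<and> before ?w' (Suc i) (Suc j)).
      \<exists>g\<in>SL_borel n. \<exists>h. similar_mat_wit X Y g h"
    using Y(2) addrow_mat_SL_borel[OF xyz(1) yn] by blast
qed (use xyz in auto)

lemma borel_closure_xzy:
  assumes d: "distinct (u @ [Suc x, Suc z, Suc y] @ v)" and xyz: "x < y" "y < z" "z < n"
  shows "borel_closure n (u @ [Suc x, Suc z, Suc y] @ v) = borel_closure n (u @ [Suc z, Suc x, Suc y] @ v)"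
  unfolding borel_closure_def word_mats_def
proof (rule closure_conj_supp_mats_eqI)
  let ?w = "u @ [Suc x, Suc z, Suc y] @ v" and ?w' = "u @ [Suc z, Suc x, Suc y] @ v"
  show "i < j \<and> before ?w (Suc i) (Suc j)" if "i < j \<and> before ?w' (Suc i) (Suc j)" for i j
    using that xyz by (auto simp: before_append)
  show "x < y \<and> before ?w (Suc x) (Suc y)" using xyz by (simp add: before_append)
  fix X assume X: "X \<in> supp_mats n (\<lambda>i j. i < j \<and> before ?w (Suc i) (Suc j))" "X $$ (x, y) \<noteq> 0"
  have Xc: "X \<in> carrier_mat n n"
    and X0: "\<And>i j. i < n \<Longrightarrow> j < n \<Longrightarrow> X $$ (i, j) \<noteq> 0 \<Longrightarrow> i < j \<and> before ?w (Suc i) (Suc j)"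
    using X by (auto simp: supp_mats_def)
  \<comment> \<open>This time the column operation clears the entry: it becomes
    \<open>X $$ (x, z) - t * X $$ (x, y)\<close>.\<close>
  define t where "t = X $$ (x, z) / X $$ (x, y)"
  define Y where "Y = addrow_mat n t y z * X * addrow_mat n (- t) y z"
  note Y = transvection_similar[OF xyz(2,3) Xc, where t = t, folded Y_def]
  \<comment> \<open>Row \<open>y\<close> receives row \<open>z\<close>, whose columns belong to
    letters in \<open>v\<close>. Column \<open>z\<close> receives column \<open>y\<close>, whose
    rows other than the cleared \<open>x\<close> belong to letters in \<open>u\<close>. So no
    forbidden position is filled.\<close>
  have "i < j \<and> before ?w' (Suc i) (Suc j)" if ij: "i < n" "j < n" "Y $$ (i, j) \<noteq> 0" for i j
  proof (cases "i = y \<or> j = z")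
    case False
    then have "X $$ (i, j) \<noteq> 0" "(i, j) \<noteq> (x, z)" using Y(3)[OF ij(1,2)] ij(3) by auto
    then show ?thesis using X0[OF ij(1,2)] False d by (auto simp: before_append dest: before_in_set)
  next
    case True
    have "X $$ (y, z) = 0" "X $$ (y, y) = 0" "X $$ (z, z) = 0" "X $$ (z, y) = 0"
      using X0[of y z] X0[of y y] X0[of z z] X0[of z y] xyz d
      by (auto simp: before_append dest: before_in_set)
    then consider "i = y" "j \<noteq> z" | "i \<noteq> y" "j = z"
      using True Y(3)[OF ij(1,2)] ij(3) by (auto split: if_splits)
    then show ?thesis
    proof cases
      case 1
      then have "X $$ (y, j) \<noteq> 0 \<or> X $$ (z, j) \<noteq> 0" using Y(3)[OF ij(1,2)] ij(3) by auto
      then show ?thesis using X0[of y j] X0[of z j] 1 xyz ij d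
        by (auto simp: before_append dest: before_in_set)
    next
      case 2
      then have Yij: "Y $$ (i, j) = X $$ (i, z) - t * X $$ (i, y)" using Y(3)[OF ij(1,2)] by simp
      then have "i \<noteq> x" using ij(3) X(2) by (auto simp: t_def)
      moreover have "X $$ (i, z) \<noteq> 0 \<or> X $$ (i, y) \<noteq> 0" using Yij ij(3) by auto
      ultimately show ?thesis using X0[of i z] X0[of i y] 2 xyz ij d
        by (auto simp: before_append dest: before_in_set)
    qed
  qed
  then have "Y \<in> supp_mats n (\<lambda>i j. i < j \<and> before ?w' (Suc i) (Suc j))"
    using Y(1) by (auto simp: supp_mats_def)
  then show "\<exists>Y\<in>supp_mats n (\<lambda>i j. i < j \<and> before ?w' (Suc i) (Suc j)).
      \<exists>g\<in>SL_borel n. \<exists>h. similar_mat_wit X Y g h"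
    using Y(2) addrow_mat_SL_borel[OF xyz(2,3)] by blast
qed (use xyz in auto)

text \<open>Equivalent words have the same letters, which carries the side conditions through
  symmetry and transitivity. Letters are positive, so the elementary moves can be rewritten with
  matrix indices.\<close>

lemma knuth_borel_closure:
  "knuth xs ys \<Longrightarrow> distinct xs \<Longrightarrow> set xs \<subseteq> {1..n} \<Longrightarrow> borel_closure n xs = borel_closure n ys"
proof (induction rule: knuth.induct)
  case (knuth_sym u v)
  then show ?case by (metis knuth_mset mset_eq_imp_distinct_iff mset_eq_setD)
next
  case (knuth_trans u v w)
  then show ?case by (metis knuth_mset mset_eq_imp_distinct_iff mset_eq_setD)
next
  case (yxz x y z u v)
  then obtain x' y' z' where "x = Suc x'" "y = Suc y'" "z = Suc z'"
    by (cases x; cases y; cases z) auto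
  then show ?case using borel_closure_yxz[of u y' x' z' v n] yxz by auto
next
  case (xzy x y z u v)
  then obtain x' y' z' where "x = Suc x'" "y = Suc y'" "z = Suc z'"
    by (cases x; cases y; cases z) auto
  then show ?case using borel_closure_xzy[of u x' z' y' v n] xzy by auto
qed simp

section \<open>From words back to tableaux\<close>

lemma word_of_perm_exists:
  assumes "distinct xs" "set xs = {1..n}"
  obtains w where "w permutes {1..n}" "word_of_perm n w = xs"
proof -
  have len: "length xs = n" using assms distinct_card[of xs] by simp
  define w where "w i = (if i \<in> {1..n} then xs ! (i - 1) else i)" for i
  have word: "word_of_perm n w = xs"
    by (rule nth_equalityI) (auto simp: word_of_perm_def w_def len simp del: upt_Suc)
  have "w ` {1..n} = set xs"
    using arg_cong[OF word, of set] by (simp add: word_of_perm_def atLeastLessThanSuc_atLeastAtMost del: upt_Suc)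
  then have "w ` {1..n} = {1..n}" using assms(2) by simp
  then have "bij_betw w {1..n} {1..n}"
    by (simp add: bij_betw_def eq_card_imp_inj_on)
  then have "w permutes {1..n}" by (rule bij_imp_permutes) (auto simp: w_def)
  then show ?thesis using that word by blast
qed

text \<open>The column word shows that the set from which \<open>SOME\<close> selects is nonempty.
  Whatever is selected, its word is Knuth equivalent to the row reading word, so the closure does
  not depend on the selection.\<close>

lemma closure_orbital_variety:
  assumes "T \<in> SYT n"
  shows "zariski_closure n (orbital_variety n T) = borel_closure n (concat (rev T))"
proof -
  have T: "tableau T" "distinct (concat T)" "set (concat T) = {1..n}" using assms by (auto simp: SYT_iff)
  let ?P = "\<lambda>w. w permutes {1..n} \<and> insertion_tableau (word_of_perm n w) = T"
  let ?c = "rev (concat (rev (List.transpose T)))"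
  have ins: "insertion_tableau ?c = T" by (rule insertion_tableau_column_word[OF T(1)])
  have "mset ?c = mset (concat T)" using mset_insertion_tableau[of ?c] ins by simp
  then have "distinct ?c" "set ?c = {1..n}"
    using T(2,3) mset_eq_imp_distinct_iff mset_eq_setD by metis+
  then obtain w0 where "?P w0" using word_of_perm_exists ins by metis
  then have "?P (SOME w. ?P w)" by (rule someI[of ?P])
  then obtain w where w: "w permutes {1..n}" "insertion_tableau (word_of_perm n w) = T"
    "orbital_variety n T = orbital_variety_perm n w"
    by (auto simp: orbital_variety_def)
  have word: "set (word_of_perm n w) = {1..n}" "distinct (word_of_perm n w)"
    using permutes_image[OF w(1)] permutes_inj_on[OF w(1)]
    by (auto simp: word_of_perm_def distinct_map atLeastLessThanSuc_atLeastAtMost simp del: upt_Suc)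
  then have "knuth (word_of_perm n w) (concat (rev T))"
    using tableau_insertion_tableau w(2) by metis
  then have "borel_closure n (word_of_perm n w) = borel_closure n (concat (rev T))"
    using word by (intro knuth_borel_closure) auto
  then show ?thesis
    using closure_orbital_variety_perm[of n w] n_cap_w_word_mats[OF w(1)] w(3)
    by (simp add: borel_closure_def)
qed

section \<open>Inserting a row and a column\<close>

text \<open>A new row and column are inserted at index \<open>k\<close>, with \<open>d\<close> in
  the corner. The border entries \<open>c\<close> and \<open>r\<close> are indexed by the old
  indices, and \<open>delete_index\<close> translates new indices into these.\<close>

definition bordered :: "nat \<Rightarrow> nat \<Rightarrow> complex \<Rightarrow> (nat \<Rightarrow> complex) \<Rightarrow> (nat \<Rightarrow> complex) \<Rightarrow> complex mat \<Rightarrow> complex mat"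
  where "bordered n k d c r X = mat (Suc n) (Suc n) (\<lambda>(i, j).
    if i = k then if j = k then d else r (delete_index k j)
    else if j = k then c (delete_index k i) else X $$ (delete_index k i, delete_index k j))"

lemma bordered_carrier [simp]: "bordered n k d c r X \<in> carrier_mat (Suc n) (Suc n)"
  by (simp add: bordered_def)

lemma insert_index_less: "k \<le> n \<Longrightarrow> i < n \<Longrightarrow> insert_index k i < Suc n"
  by (simp add: insert_index_def)

lemma delete_index_less: "k \<le> n \<Longrightarrow> i < Suc n \<Longrightarrow> i \<noteq> k \<Longrightarrow> delete_index k i < n"
  by (auto simp: delete_index_def)

lemma insert_index_less_iff: "insert_index k i < insert_index k j \<longleftrightarrow> i < j"
  by (auto simp: insert_index_def)

lemma insert_index_cases:
  assumes "k \<le> n" "i < Suc n"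
  obtains "i = k" | l where "l < n" "i = insert_index k l"
  using assms delete_index_less insert_delete_index by metis

lemma bordered_index [simp]:
  assumes "k \<le> n"
  shows "bordered n k d c r X $$ (k, k) = d"
    and "j < n \<Longrightarrow> bordered n k d c r X $$ (k, insert_index k j) = r j"
    and "i < n \<Longrightarrow> bordered n k d c r X $$ (insert_index k i, k) = c i"
    and "i < n \<Longrightarrow> j < n \<Longrightarrow>
      bordered n k d c r X $$ (insert_index k i, insert_index k j) = X $$ (i, j)"
  using assms by (simp_all add: bordered_def insert_index_less)

lemma bordered_eqI:
  assumes k: "k \<le> n" and M: "M \<in> carrier_mat (Suc n) (Suc n)"
    and "M $$ (k, k) = d" "\<And>j. j < n \<Longrightarrow> M $$ (k, insert_index k j) = r j"
    "\<And>i. i < n \<Longrightarrow> M $$ (insert_index k i, k) = c i"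
    "\<And>i j. i < n \<Longrightarrow> j < n \<Longrightarrow> M $$ (insert_index k i, insert_index k j) = X $$ (i, j)"
  shows "M = bordered n k d c r X"
proof (rule eq_matI)
  fix i j assume "i < dim_row (bordered n k d c r X)" "j < dim_col (bordered n k d c r X)"
  then have "i < Suc n" "j < Suc n" by (simp_all add: bordered_def)
  then show "M $$ (i, j) = bordered n k d c r X $$ (i, j)"
    using assms by (elim insert_index_cases[OF k]) simp_all
qed (use M in \<open>auto simp: bordered_def\<close>)

lemma sum_insert_index:
  fixes f :: "nat \<Rightarrow> 'a::comm_monoid_add"
  assumes "k \<le> n"
  shows "(\<Sum>l<Suc n. f l) = f k + (\<Sum>l<n. f (insert_index k l))"
proof -
  have "{..<Suc n} = insert k (insert_index k ` {..<n})"
    using insert_index_image[of k n] assms by (auto simp: lessThan_atLeast0)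
  moreover have "k \<notin> insert_index k ` {..<n}" using insert_index_exclude by (metis imageE)
  ultimately have "(\<Sum>l<Suc n. f l) = f k + sum f (insert_index k ` {..<n})"
    by (simp del: sum.lessThan_Suc)
  also have "sum f (insert_index k ` {..<n}) = (\<Sum>l<n. f (insert_index k l))"
    using insert_index_inj_on by (simp add: sum.reindex)
  finally show ?thesis .
qed

lemma bordered_mult_left:
  assumes k: "k \<le> n" and g: "g \<in> carrier_mat n n" and X: "X \<in> carrier_mat n n"
  shows "bordered n k 1 (\<lambda>i. 0) (\<lambda>j. 0) g * bordered n k d c r X =
    bordered n k d (\<lambda>i. \<Sum>l<n. g $$ (i, l) * c l) r (g * X)"
  using k insert_index_less[OF k]
  by (intro bordered_eqI)
    (simp_all add: mult_mat_entry[OF bordered_carrier bordered_carrier] sum_insert_index[OF k]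
      mult_mat_entry[OF g X] mult_carrier_mat[OF bordered_carrier bordered_carrier]
      del: sum.lessThan_Suc)

lemma bordered_mult_right:
  assumes k: "k \<le> n" and X: "X \<in> carrier_mat n n" and h: "h \<in> carrier_mat n n"
  shows "bordered n k d c r X * bordered n k 1 (\<lambda>i. 0) (\<lambda>j. 0) h =
    bordered n k d c (\<lambda>j. \<Sum>l<n. r l * h $$ (l, j)) (X * h)"
  using k insert_index_less[OF k]
  by (intro bordered_eqI)
    (simp_all add: mult_mat_entry[OF bordered_carrier bordered_carrier] sum_insert_index[OF k]
      mult_mat_entry[OF X h] mult_carrier_mat[OF bordered_carrier bordered_carrier]
      del: sum.lessThan_Suc)

lemma bordered_one: "k \<le> n \<Longrightarrow> bordered n k 1 (\<lambda>i. 0) (\<lambda>j. 0) (1\<^sub>m n) = 1\<^sub>m (Suc n)"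
  by (rule bordered_eqI[symmetric])
    (auto simp: insert_index_less insert_index_inj_on[THEN inj_on_eq_iff[of _ UNIV]]
      insert_index_exclude[symmetric])

lemma bordered_SL_borel:
  assumes k: "k \<le> n" and g: "g \<in> SL_borel n"
  shows "bordered n k 1 (\<lambda>i. 0) (\<lambda>j. 0) g \<in> SL_borel (Suc n)"
proof -
  let ?G = "bordered n k 1 (\<lambda>i. 0) (\<lambda>j. 0) g"
  have gc: "g \<in> carrier_mat n n" "det g = 1" "upper_triangular g" using g by (auto simp: SL_borel_def SL_def)
  have "mat_delete ?G k k = g"
  proof (rule eq_matI)
    fix i j assume "i < dim_row g" "j < dim_col g"
    then have ij: "i < n" "j < n" using gc(1) by auto
    have "mat_delete ?G k k $$ (i, j) = ?G $$ (insert_index k i, insert_index k j)"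
      by (rule mat_delete_index[symmetric, OF bordered_carrier]) (use k ij in auto)
    then show "mat_delete ?G k k $$ (i, j) = g $$ (i, j)" using k ij by simp
  qed (use gc(1) in \<open>auto simp: mat_delete_def bordered_def\<close>)
  then have "cofactor ?G k k = det g" by (simp add: cofactor_def flip: mult_2)
  \<comment> \<open>Row \<open>k\<close> is a unit vector, so the expansion along it reduces to the
    diagonal cofactor.\<close>
  moreover have "det ?G = (\<Sum>j<Suc n. ?G $$ (k, j) * cofactor ?G k j)"
    by (rule laplace_expansion_row) (use k in auto)
  ultimately have "det ?G = 1"
    using sum_insert_index[OF k, of "\<lambda>j. ?G $$ (k, j) * cofactor ?G k j"] k gc(2)
    by (simp del: sum.lessThan_Suc)
  moreover have "upper_triangular ?G"
  proof (rule upper_triangularI)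
    fix i j assume ij: "j < i" "i < dim_row ?G"
    then have "i < Suc n" "j < Suc n" by (simp_all add: bordered_def)
    then show "?G $$ (i, j) = 0"
      using ij(1) k gc by (elim insert_index_cases[OF k]) (auto simp: insert_index_less_iff)
  qed
  ultimately show ?thesis by (simp add: SL_borel_def SL_def)
qed

text \<open>Conjugation by the bordered \<open>g\<close> multiplies the border column by
  \<open>g\<close> and the border row by \<open>h\<close>. The border of \<open>X\<close> carries
  the opposite factors, so that the border of \<open>Y\<close> can be prescribed.\<close>

lemma similar_mat_wit_bordered:
  assumes k: "k \<le> n" and w: "similar_mat_wit Y X g h" and Y: "Y \<in> carrier_mat n n"
  shows "similar_mat_wit (bordered n k d c r Y)
    (bordered n k d (\<lambda>i. \<Sum>l<n. h $$ (i, l) * c l) (\<lambda>j. \<Sum>l<n. r l * g $$ (l, j)) X)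
    (bordered n k 1 (\<lambda>i. 0) (\<lambda>j. 0) g) (bordered n k 1 (\<lambda>i. 0) (\<lambda>j. 0) h)"
proof -
  note w = similar_mat_witD2[OF Y w]
  let ?G = "bordered n k 1 (\<lambda>i. 0) (\<lambda>j. 0) g" and ?H = "bordered n k 1 (\<lambda>i. 0) (\<lambda>j. 0) h"
  have GH: "?G * ?H = 1\<^sub>m (Suc n)" "?H * ?G = 1\<^sub>m (Suc n)"
    using bordered_mult_left[OF k w(6,7), of 1 "\<lambda>i. 0" "\<lambda>i. 0"]
      bordered_mult_left[OF k w(7,6), of 1 "\<lambda>i. 0" "\<lambda>i. 0"] w(1,2) bordered_one[OF k] by simp_all
  let ?c = "\<lambda>i. \<Sum>l<n. h $$ (i, l) * c l" and ?r = "\<lambda>j. \<Sum>l<n. r l * g $$ (l, j)"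
  have "h * Y * g = X"
    using similar_mat_witD2(3)[OF _ similar_mat_wit_sym[OF assms(2)]] w(5) by simp
  moreover have "?H * bordered n k d c r Y * ?G = bordered n k d ?c ?r (h * Y * g)"
    using w by (simp add: bordered_mult_left[OF k] bordered_mult_right[OF k])
  ultimately have "similar_mat_wit (bordered n k d ?c ?r X) (bordered n k d c r Y) ?H ?G"
    using GH by (intro similar_mat_witI[of _ _ "Suc n"]) auto
  then show ?thesis by (rule similar_mat_wit_sym)
qed

lemma bordered_sl: "k \<le> n \<Longrightarrow> X \<in> sl n \<Longrightarrow> bordered n k 0 c r X \<in> sl (Suc n)"
  by (simp add: sl_def sum_insert_index del: sum.lessThan_Suc)

lemma poly_map_bordered:
  assumes "k \<le> n"
  shows "poly_map n (Suc n) (bordered n k d c r)"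
  unfolding poly_map_def
proof (intro conjI allI impI ballI)
  fix i j assume "i < Suc n" "j < Suc n"
  then show "poly_on n (\<lambda>X. bordered n k d c r X $$ (i, j))"
    using assms by (elim insert_index_cases[OF assms]) (auto intro: poly_on_const poly_on_coord)
qed simp

text \<open>With \<open>c\<close> and \<open>r\<close> fixed, bordering is a polynomial map in
  \<open>X\<close>, so only conjugates of members of \<open>K\<close> have to be checked. For these
  the conjugation moves to the border, and the last hypothesis asks \<open>K'\<close> to contain
  every border that arises.\<close>

lemma bordered_in_closure:
  assumes k: "k \<le> n" and K: "K \<subseteq> sl n" "K' \<subseteq> sl (Suc n)"
    and X: "X \<in> zariski_closure n (conj_sat (SL_borel n) K)"
    and K': "\<And>Y g h. Y \<in> K \<Longrightarrow> g \<in> SL_borel n \<Longrightarrow> h \<in> carrier_mat n n \<Longrightarrow> g * h = 1\<^sub>m n \<Longrightarrow>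
      bordered n k 0 (\<lambda>i. \<Sum>l<n. h $$ (i, l) * c l) (\<lambda>j. \<Sum>l<n. r l * g $$ (l, j)) Y \<in> K'"
  shows "bordered n k 0 c r X \<in> zariski_closure (Suc n) (conj_sat (SL_borel (Suc n)) K')"
proof (rule zariski_closure_poly_map[OF poly_map_bordered[OF k] _ _ X])
  have sub: "conj_sat (SL_borel n) K \<subseteq> sl n" by (rule conj_sat_sl[OF K(1)])
  then show "conj_sat (SL_borel n) K \<subseteq> carrier_mat n n" using sl_carrier by blast
  fix Z assume Z: "Z \<in> conj_sat (SL_borel n) K"
  then obtain Y g h where Y: "Y \<in> K" "g \<in> SL_borel n" and w: "similar_mat_wit Z Y g h"
    by (auto simp: conj_sat_def)
  have Zc: "Z \<in> carrier_mat n n" using Z sub sl_carrier by blast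
  have "bordered n k 0 c r Z \<in> conj_sat (SL_borel (Suc n)) K'"
    using similar_mat_wit_bordered[OF k w Zc, of 0 c r] bordered_SL_borel[OF k Y(2)]
      K'[OF Y similar_mat_witD2(7,1)[OF Zc w]] by (auto simp: conj_sat_def)
  then show "bordered n k 0 c r Z \<in> zariski_closure (Suc n) (conj_sat (SL_borel (Suc n)) K')"
    using subset_zariski_closure[OF conj_sat_sl[OF K(2)]] by blast
next
  show "bordered n k 0 c r X \<in> sl (Suc n)"
    using X zariski_closure_subset_sl by (blast intro: bordered_sl[OF k])
qed

text \<open>Upward from the last row: once the lower rows of \<open>h\<close> vanish to the left of
  the diagonal, the entry \<open>(i, j)\<close> of \<open>g * h\<close> reduces to
  \<open>g $$ (i, i) * h $$ (i, j)\<close>, and the diagonal of \<open>g\<close> has no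
  zeros.\<close>

lemma upper_triangular_right_inverse:
  fixes g h :: "'a::idom mat"
  assumes g: "g \<in> carrier_mat n n" "upper_triangular g" "det g \<noteq> 0"
    and h: "h \<in> carrier_mat n n" "g * h = 1\<^sub>m n"
  shows "j < i \<Longrightarrow> i < n \<Longrightarrow> h $$ (i, j) = 0"
proof (induction "n - i" arbitrary: i rule: less_induct)
  case less
  have "0 \<notin> set (diag_mat g)" using upper_triangular_imp_det_eq_0_iff[OF g(1,2)] g(3) by simp
  then have gii: "g $$ (i, i) \<noteq> 0" using less.prems g(1) by (auto simp: diag_mat_def)
  have "g $$ (i, l) * h $$ (l, j) = 0" if "l < n" "l \<noteq> i" for l
  proof (cases "l < i")
    case True
    then show ?thesis using upper_triangularD[OF g(2)] less.prems g(1) by simp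
  next
    case False
    then show ?thesis using less.hyps[of l] less.prems that by simp
  qed
  then have "(\<Sum>l<n. g $$ (i, l) * h $$ (l, j)) = (\<Sum>l<n. if l = i then g $$ (i, i) * h $$ (i, j) else 0)"
    by (intro sum.cong) auto
  then have "g $$ (i, i) * h $$ (i, j) = (g * h) $$ (i, j)"
    using mult_mat_entry[OF g(1) h(1), of i j] less.prems by simp
  also have "\<dots> = 0" using h(2) less.prems by simp
  finally show ?case using gii by simp
qed

section \<open>Words with one further letter\<close>

definition raise :: "nat \<Rightarrow> nat \<Rightarrow> nat" where
  "raise a b = (if a \<le> b then b + 1 else b)"

lemma strict_mono_raise: "strict_mono (raise a)"
  by (auto simp: strict_mono_def raise_def)

lemma raise_neq: "raise a b \<noteq> a"
  by (simp add: raise_def)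

text \<open>Raising letters, counted from 1, is the same operation as inserting an index, counted
  from 0. This links the longer word with the bordered matrix.\<close>

lemma raise_Suc: "raise (Suc k) (Suc i) = Suc (insert_index k i)"
  by (simp add: raise_def insert_index_def)

lemma raise_image: "a \<in> {1..n + 1} \<Longrightarrow> insert a (raise a ` {1..n}) = {1..n + 1}"
proof (intro equalityI subsetI)
  fix b assume ab: "a \<in> {1..n + 1}" "b \<in> {1..n + 1}"
  obtain b' where "b = Suc b'" using ab(2) by (cases b) auto
  then consider "b = a" | "b = raise a b" "b \<in> {1..n}" | "b = raise a b'" "b' \<in> {1..n}"
    using ab by (cases b a rule: linorder_cases) (auto simp: raise_def)
  then show "b \<in> insert a (raise a ` {1..n})" by cases blast+
qed (auto simp: raise_def split: if_splits)

lemma before_map_raise: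
  "before (map (raise (Suc k)) xs) (Suc (insert_index k i)) (Suc (insert_index k j)) \<longleftrightarrow>
    before xs (Suc i) (Suc j)"
  using before_map[OF strict_mono_imp_inj_on[OF strict_mono_raise]] by (metis raise_Suc)

text \<open>A last letter precedes no other, so its row vanishes, and its column can be nonzero
  above the diagonal only.\<close>

lemma word_mats_snoc:
  assumes k: "k \<le> n" and M: "M \<in> word_mats (Suc n) (map (raise (Suc k)) xs @ [Suc k])"
  obtains X c where "X \<in> word_mats n xs" "\<And>i. k \<le> i \<Longrightarrow> c i = 0" "M = bordered n k 0 c (\<lambda>j. 0) X"
proof -
  let ?ys = "map (raise (Suc k)) xs @ [Suc k]"
  have Mc: "M \<in> carrier_mat (Suc n) (Suc n)"
    and M0: "\<And>i j. i < Suc n \<Longrightarrow> j < Suc n \<Longrightarrow> M $$ (i, j) \<noteq> 0 \<Longrightarrow> i < j \<and> before ?ys (Suc i) (Suc j)"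
    using M by (auto simp: word_mats_def supp_mats_def)
  define X where "X = mat n n (\<lambda>(i, j). M $$ (insert_index k i, insert_index k j))"
  \<comment> \<open>The value 0 from \<open>k\<close> on agrees with \<open>M\<close> below the
    diagonal and also fixes \<open>c\<close> outside the matrix.\<close>
  define c where "c i = (if i < k then M $$ (insert_index k i, k) else 0)" for i
  have "X \<in> word_mats n xs"
    using M0[OF insert_index_less[OF k] insert_index_less[OF k]] before_map_raise[of k xs]
    by (fastforce simp: word_mats_def supp_mats_def X_def before_append insert_index_less_iff)
  moreover have "M = bordered n k 0 c (\<lambda>j. 0) X"
  proof (rule bordered_eqI[OF k Mc])
    show "M $$ (k, k) = 0" using M0[of k k] k by auto
    show "M $$ (k, insert_index k j) = 0" if "j < n" for j
    proof -
      have "Suc k \<notin> set (map (raise (Suc k)) xs)" using raise_neq by (metis ex_map_conv)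
      then have "\<not> before ?ys (Suc k) (Suc (insert_index k j))"
        using before_in_set[of "map (raise (Suc k)) xs"] by (fastforce simp: before_append)
      then show ?thesis using M0[of k "insert_index k j"] insert_index_less[OF k that] k by auto
    qed
    show "M $$ (insert_index k i, k) = c i" if "i < n" for i
      using M0[of "insert_index k i" k] insert_index_less[OF k that] k
      by (cases "i < k") (auto simp: c_def)
  qed (simp add: X_def)
  ultimately show ?thesis using that[of X c] by (simp add: c_def)
qed

text \<open>All letters up to \<open>n\<close> occur in \<open>xs\<close>, so all of them precede
  the appended letter after raising; hence every entry of the column above the diagonal is
  allowed.\<close>

lemma bordered_word_mats_snoc:
  assumes k: "k \<le> n" and X: "X \<in> word_mats n xs" and c: "\<And>i. k \<le> i \<Longrightarrow> i < n \<Longrightarrow> c i = 0"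
    and xs: "{1..n} \<subseteq> set xs"
  shows "bordered n k 0 c (\<lambda>j. 0) X \<in> word_mats (Suc n) (map (raise (Suc k)) xs @ [Suc k])"
  unfolding word_mats_def supp_mats_def
proof (intro CollectI conjI allI impI)
  let ?ys = "map (raise (Suc k)) xs @ [Suc k]"
  fix i j assume "i < Suc n" "j < Suc n" and nz: "bordered n k 0 c (\<lambda>j. 0) X $$ (i, j) \<noteq> 0"
  then have "i < j \<and> before ?ys (Suc i) (Suc j)"
  proof (elim insert_index_cases[OF k])
    fix l assume l: "l < n" "i = insert_index k l" "j = k"
    have "c l \<noteq> 0" using nz unfolding l(2,3) bordered_index(3)[OF k l(1)] .
    then have "l < k" using c[of l] l(1) by (cases "l < k") auto
    moreover have "Suc l \<in> set xs" using l(1) xs by auto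
    ultimately show ?thesis using l by (force simp: before_append raise_def)
  next
    fix l m assume lm: "l < n" "i = insert_index k l" "m < n" "j = insert_index k m"
    then have "l < m" "before xs (Suc l) (Suc m)" using nz k X by (auto simp: word_mats_def supp_mats_def)
    then show ?thesis using lm before_map_raise by (auto simp: before_append insert_index_less_iff)
  qed (use nz k in auto)
  then show "i < j" "before ?ys (Suc i) (Suc j)" by auto
qed simp

text \<open>A first letter is preceded by no other, so its column vanishes. Old indices from
  \<open>k\<close> on are those to the right of the new diagonal entry, where its row is
  free.\<close>

lemma word_mats_Cons:
  assumes k: "k \<le> n" and M: "M \<in> word_mats (Suc n) (Suc k # map (raise (Suc k)) xs)"
  obtains X r where "X \<in> word_mats n xs" "\<And>j. j < k \<Longrightarrow> r j = 0" "M = bordered n k 0 (\<lambda>i. 0) r X"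
proof -
  let ?ys = "Suc k # map (raise (Suc k)) xs"
  have Mc: "M \<in> carrier_mat (Suc n) (Suc n)"
    and M0: "\<And>i j. i < Suc n \<Longrightarrow> j < Suc n \<Longrightarrow> M $$ (i, j) \<noteq> 0 \<Longrightarrow> i < j \<and> before ?ys (Suc i) (Suc j)"
    using M by (auto simp: word_mats_def supp_mats_def)
  define X where "X = mat n n (\<lambda>(i, j). M $$ (insert_index k i, insert_index k j))"
  define r where "r j = (if j < k then 0 else M $$ (k, insert_index k j))" for j
  have "before ?ys (Suc (insert_index k i)) (Suc (insert_index k j)) \<longleftrightarrow> before xs (Suc i) (Suc j)" for i j
    using before_map_raise[of k xs i j] insert_index_exclude[of k i, symmetric] by auto
  then have "X \<in> word_mats n xs"
    using M0[OF insert_index_less[OF k] insert_index_less[OF k]]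
    by (auto simp: word_mats_def supp_mats_def X_def insert_index_less_iff)
  moreover have "M = bordered n k 0 (\<lambda>i. 0) r X"
  proof (rule bordered_eqI[OF k Mc])
    show "M $$ (k, k) = 0" using M0[of k k] k by auto
    show "M $$ (insert_index k i, k) = 0" if "i < n" for i
    proof -
      have "Suc k \<notin> set (map (raise (Suc k)) xs)" using raise_neq by (metis ex_map_conv)
      then have "\<not> before ?ys (Suc (insert_index k i)) (Suc k)"
        using before_in_set[of "map (raise (Suc k)) xs"] by fastforce
      then show ?thesis using M0[of "insert_index k i" k] insert_index_less[OF k that] k by auto
    qed
    show "M $$ (k, insert_index k j) = r j" if "j < n" for j
      using M0[of k "insert_index k j"] insert_index_less[OF k that] k
      by (cases "j < k") (auto simp: r_def)
  qed (simp add: X_def)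
  ultimately show ?thesis using that[of X r] by (simp add: r_def)
qed

lemma bordered_word_mats_Cons:
  assumes k: "k \<le> n" and X: "X \<in> word_mats n xs" and r: "\<And>j. j < k \<Longrightarrow> r j = 0"
    and xs: "{1..n} \<subseteq> set xs"
  shows "bordered n k 0 (\<lambda>i. 0) r X \<in> word_mats (Suc n) (Suc k # map (raise (Suc k)) xs)"
  unfolding word_mats_def supp_mats_def
proof (intro CollectI conjI allI impI)
  let ?ys = "Suc k # map (raise (Suc k)) xs"
  fix i j assume "i < Suc n" "j < Suc n" and nz: "bordered n k 0 (\<lambda>i. 0) r X $$ (i, j) \<noteq> 0"
  then have "i < j \<and> before ?ys (Suc i) (Suc j)"
  proof (elim insert_index_cases[OF k])
    fix l assume l: "i = k" "l < n" "j = insert_index k l"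
    have "r l \<noteq> 0" using nz unfolding l(1,3) bordered_index(2)[OF k l(2)] .
    then have "k \<le> l" using r[of l] by (cases "l < k") auto
    moreover have "Suc l \<in> set xs" using l(2) xs by auto
    ultimately show ?thesis using l by (force simp: raise_def)
  next
    fix l m assume lm: "l < n" "i = insert_index k l" "m < n" "j = insert_index k m"
    then have "l < m" "before xs (Suc l) (Suc m)" using nz k X by (auto simp: word_mats_def supp_mats_def)
    then show ?thesis using lm before_map_raise by (auto simp: insert_index_less_iff)
  qed (use nz k in auto)
  then show "i < j" "before ?ys (Suc i) (Suc j)" by auto
qed simp

lemma borel_closure_snoc_mono:
  assumes k: "k \<le> n" and le: "borel_closure n xs \<subseteq> borel_closure n ys" and ys: "{1..n} \<subseteq> set ys"
  shows "borel_closure (Suc n) (map (raise (Suc k)) xs @ [Suc k]) \<subseteq>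
    borel_closure (Suc n) (map (raise (Suc k)) ys @ [Suc k])"
  unfolding borel_closure_def
proof (rule closure_conj_sat_le[OF mat_submonoid_SL_borel word_mats_sl], rule subsetI)
  fix M assume "M \<in> word_mats (Suc n) (map (raise (Suc k)) xs @ [Suc k])"
  then obtain X c where X: "X \<in> word_mats n xs" and c: "\<And>i. k \<le> i \<Longrightarrow> c i = 0"
    and M: "M = bordered n k 0 c (\<lambda>j. 0) X"
    using word_mats_snoc[OF k] by blast
  have "X \<in> zariski_closure n (conj_sat (SL_borel n) (word_mats n ys))"
    using X word_mats_subset_borel_closure le unfolding borel_closure_def by blast
  then show "M \<in> zariski_closure (Suc n) (conj_sat (SL_borel (Suc n))
      (word_mats (Suc n) (map (raise (Suc k)) ys @ [Suc k])))"
    unfolding M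
  proof (rule bordered_in_closure[OF k word_mats_sl word_mats_sl])
    fix Y g h assume Y: "Y \<in> word_mats n ys" and g: "g \<in> SL_borel n"
      and h: "h \<in> carrier_mat n n" "g * h = 1\<^sub>m n"
    \<comment> \<open>The inverse \<open>h\<close> is upper triangular, so it maps vectors supported
      on the first \<open>k\<close> coordinates to such vectors.\<close>
    have "(\<Sum>l<n. h $$ (i, l) * c l) = 0" if "k \<le> i" "i < n" for i
    proof (rule sum.neutral, rule ballI)
      fix l assume "l \<in> {..<n}"
      then show "h $$ (i, l) * c l = 0"
        using upper_triangular_right_inverse[of g n h l i] g h c[of l] that
        by (cases "k \<le> l") (auto simp: SL_borel_def SL_def)
    qed
    then show "bordered n k 0 (\<lambda>i. \<Sum>l<n. h $$ (i, l) * c l) (\<lambda>j. \<Sum>l<n. 0 * g $$ (l, j)) Y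
      \<in> word_mats (Suc n) (map (raise (Suc k)) ys @ [Suc k])"
      using bordered_word_mats_snoc[OF k Y _ ys] by simp
  qed
qed

lemma borel_closure_Cons_mono:
  assumes k: "k \<le> n" and le: "borel_closure n xs \<subseteq> borel_closure n ys" and ys: "{1..n} \<subseteq> set ys"
  shows "borel_closure (Suc n) (Suc k # map (raise (Suc k)) xs) \<subseteq>
    borel_closure (Suc n) (Suc k # map (raise (Suc k)) ys)"
  unfolding borel_closure_def
proof (rule closure_conj_sat_le[OF mat_submonoid_SL_borel word_mats_sl], rule subsetI)
  fix M assume "M \<in> word_mats (Suc n) (Suc k # map (raise (Suc k)) xs)"
  then obtain X r where X: "X \<in> word_mats n xs" and r: "\<And>j. j < k \<Longrightarrow> r j = 0"
    and M: "M = bordered n k 0 (\<lambda>i. 0) r X"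
    using word_mats_Cons[OF k] by blast
  have "X \<in> zariski_closure n (conj_sat (SL_borel n) (word_mats n ys))"
    using X word_mats_subset_borel_closure le unfolding borel_closure_def by blast
  then show "M \<in> zariski_closure (Suc n) (conj_sat (SL_borel (Suc n))
      (word_mats (Suc n) (Suc k # map (raise (Suc k)) ys)))"
    unfolding M
  proof (rule bordered_in_closure[OF k word_mats_sl word_mats_sl])
    fix Y g h assume Y: "Y \<in> word_mats n ys" and g: "g \<in> SL_borel n"
    have gt: "g \<in> carrier_mat n n" "upper_triangular g" using g by (auto simp: SL_borel_def SL_def)
    define r' where "r' j = (if j < n then \<Sum>l<n. r l * g $$ (l, j) else 0)" for j
    \<comment> \<open>Multiplication by the upper triangular \<open>g\<close> on the right preserves
      row vectors whose first \<open>k\<close> entries vanish.\<close>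
    have "(\<Sum>l<n. r l * g $$ (l, j)) = 0" if "j < k" for j
    proof (rule sum.neutral, rule ballI)
      fix l assume "l \<in> {..<n}"
      then show "r l * g $$ (l, j) = 0"
        using upper_triangularD[OF gt(2), of j l] gt(1) r[of l] that by (cases "l < k") auto
    qed
    then show "bordered n k 0 (\<lambda>i. \<Sum>l<n. h $$ (i, l) * 0) (\<lambda>j. \<Sum>l<n. r l * g $$ (l, j)) Y
      \<in> word_mats (Suc n) (Suc k # map (raise (Suc k)) ys)"
      using bordered_word_mats_Cons[OF k Y _ ys] by simp
  qed
qed

section \<open>Insertion into raised tableaux\<close>

lemma raise_entries_eq: "raise_entries a T = map (map (raise a)) T"
  by (simp add: raise_entries_def raise_def[abs_def])

lemma tableau_map:
  assumes "strict_mono f" "tableau T"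
  shows "tableau (map (map f) T)"
  unfolding tableau_def
proof (intro conjI allI impI)
  fix i j assume ij: "Suc i < length (map (map f) T)" "j < length (map (map f) T ! Suc i)"
  then have "T ! i ! j < T ! Suc i ! j" "length (T ! Suc i) \<le> length (T ! i)"
    using assms(2) by (auto simp: tableau_def sorted_wrt_iff_nth_less)
  then show "map (map f) T ! i ! j < map (map f) T ! Suc i ! j"
    using assms(1) ij by (simp add: strict_mono_less)
qed (use assms in \<open>auto simp: tableau_def sorted_wrt_map comp_def strict_mono_less\<close>)

lemma geom_le_iff:
  "geom_le n T S \<longleftrightarrow> T \<in> SYT n \<and> S \<in> SYT n \<and>
    borel_closure n (concat (rev S)) \<subseteq> borel_closure n (concat (rev T))"
  by (auto simp: geom_le_def closure_orbital_variety)

text \<open>\<open>w\<close> is the row reading word of the raised tableau. Both insertions yield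
  tableaux whose reading words are Knuth equivalent to \<open>w\<close> with \<open>a\<close> added
  at one end, so the closures can be computed from these words.\<close>

lemma insert_SYT:
  assumes T: "T \<in> SYT n" and a: "a \<in> {1..n + 1}"
  defines "w \<equiv> map (raise a) (concat (rev T))"
  shows "row_insert (raise_entries a T) a \<in> SYT (n + 1)"
    and "col_insert a (raise_entries a T) \<in> SYT (n + 1)"
    and "borel_closure (n + 1) (concat (rev (row_insert (raise_entries a T) a))) = borel_closure (n + 1) (w @ [a])"
    and "borel_closure (n + 1) (concat (rev (col_insert a (raise_entries a T)))) = borel_closure (n + 1) (a # w)"
proof -
  let ?R = "raise_entries a T"
  have T': "tableau T" "distinct (concat T)" "set (concat T) = {1..n}" using T by (auto simp: SYT_iff)
  have R: "tableau ?R" unfolding raise_entries_eq by (rule tableau_map[OF strict_mono_raise T'(1)])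
  have cR: "concat ?R = map (raise a) (concat T)" by (simp add: raise_entries_eq map_concat)
  have dR: "distinct (concat ?R)" unfolding cR
    using T'(2) by (simp only: distinct_map) (blast intro: inj_on_subset[OF strict_mono_imp_inj_on[OF strict_mono_raise]])
  have sR: "set (concat ?R) = raise a ` {1..n}" unfolding cR using T'(3) by (metis set_map)
  have aR: "a \<notin> set (concat ?R)" unfolding sR using raise_neq by (metis imageE)
  have w: "concat (rev ?R) = w" by (simp add: w_def raise_entries_eq map_concat rev_map)
  have mw: "mset w = mset (concat ?R)" unfolding w[symmetric] by (simp add: mset_concat rev_map[symmetric] sum_list_rev)
  have set: "insert a (set (concat ?R)) = {1..n + 1}" unfolding sR by (rule raise_image[OF a])
  have dist: "distinct U \<and> set U = {1..n + 1}" if "mset U = add_mset a (mset (concat ?R))" for U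
  proof -
    have "mset U = mset (a # concat ?R)" using that by simp
    then show ?thesis
      using dR aR set mset_eq_imp_distinct_iff[of U "a # concat ?R"] mset_eq_setD[of U "a # concat ?R"] by simp
  qed
  show "row_insert ?R a \<in> SYT (n + 1)"
    using tableau_row_insert[OF R dR aR] dist[OF mset_row_insert] by (simp add: SYT_iff)
  show "col_insert a ?R \<in> SYT (n + 1)"
    using col_insert_tableau(1)[OF R dR aR] dist[OF col_insert_tableau(2)[OF R dR aR]] by (simp add: SYT_iff)
  have "knuth (w @ [a]) (concat (rev (row_insert ?R a)))"
    using knuth_row_insert[OF R dR aR] w by simp
  moreover have "distinct (w @ [a]) \<and> set (w @ [a]) = {1..n + 1}" using dist[of "w @ [a]"] mw by simp
  ultimately show "borel_closure (n + 1) (concat (rev (row_insert ?R a))) = borel_closure (n + 1) (w @ [a])"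
    using knuth_borel_closure[of "w @ [a]" _ "n + 1"] by simp
  have "knuth (a # w) (concat (rev (col_insert a ?R)))"
    using col_insert_tableau(3)[OF R dR aR] w by simp
  moreover have "distinct (a # w) \<and> set (a # w) = {1..n + 1}" using dist[of "a # w"] mw by simp
  ultimately show "borel_closure (n + 1) (concat (rev (col_insert a ?R))) = borel_closure (n + 1) (a # w)"
    using knuth_borel_closure[of "a # w" _ "n + 1"] by simp
qed

theorem proposition6p6:
  fixes n a :: nat and S T :: "nat list list"
  assumes "S \<in> SYT n" and "T \<in> SYT n"
    and "geom_le n S T"
    and "a \<in> {1..n + 1}"
  shows "geom_le (n + 1) (row_insert (raise_entries a S) a) (row_insert (raise_entries a T) a)
    \<and> geom_le (n + 1) (col_insert a (raise_entries a S)) (col_insert a (raise_entries a T))"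
proof -
  obtain k where k: "a = Suc k" "k \<le> n" using assms(4) by (cases a) auto
  \<comment> \<open>The geometric order reverses inclusion: the larger tableau \<open>T\<close> has
    the smaller closure.\<close>
  have le: "borel_closure n (concat (rev T)) \<subseteq> borel_closure n (concat (rev S))"
    using assms(3) by (simp add: geom_le_iff)
  have S: "{1..n} \<subseteq> set (concat (rev S))" using assms(1) by (auto simp: SYT_iff)
  show ?thesis
    unfolding geom_le_iff insert_SYT(3,4)[OF assms(1,4)] insert_SYT(3,4)[OF assms(2,4)]
    using insert_SYT(1,2)[OF assms(1,4)] insert_SYT(1,2)[OF assms(2,4)]
      borel_closure_snoc_mono[OF k(2) le S] borel_closure_Cons_mono[OF k(2) le S] k(1)
    by simp
qed

end
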